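(* Let $m\ge n$, let $A$ be an $m\times n$ matrix of rank $r$ with (thin) singular value decomposition $A=U\Sigma V^{*}=U_r\Sigma_rV_r^{*}$, let $E$ be any $m\times n$ matrix, and let $S^{+}=V_r\Sigma_r^{-1/2}U_r^{*}$. If $k=\|S^{+}ES^{+}\|\le 1$, then $$\sigma_{m+n-2r+i}(A+E)\le \sigma_i(A)+k\,\sigma_i(A)\quad\text{for every } i\in\{1,\dots,2r-m\},$$ and $$\sigma_i(A+E)\ge \sigma_i(A)-k\,\sigma_i(A)\quad\text{for every } i\in\{1,\dots,r\}.$$
   Context: All matrices are complex. $\|\cdot\|$ is the matrix 2-norm (largest singular value). Singular values $\sigma_1\ge\sigma_2\ge\dots\ge\sigma_n$ of an $m\times n$ matrix ($m\ge n$) are in decreasing order. In the decomposition, $U$ is $m\times n$ with orthonormal columns, $V$ is $n\times n$ unitary, $\Sigma=\mathrm{diag}(\sigma_1(A),\dots,\sigma_n(A))$; $\Sigma_r=\mathrm{diag}(\sigma_1(A),\dots,\sigma_r(A))$ contains the nonzero singular values and $U_r$ ($m\times r$), $V_r$ ($n\times r$) consist of the first $r$ columns of $U$ and $V$. The index set $\{1,\dots,2r-m\}$ is empty if $2r-m<1$. *)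

theory Defs
  imports
    "HOL-Library.Multiset"
    "HOL-Computational_Algebra.Fundamental_Theorem_Algebra"
    "Jordan_Normal_Form.Matrix"
    "Jordan_Normal_Form.Char_Poly"
    "Jordan_Normal_Form.Schur_Decomposition"
    "Jordan_Normal_Form.DL_Rank"
begin

text \<open>The eigenvalues of \<open>A\<^sup>*A\<close> are real and nonnegative, so \<open>Re\<close> loses nothing.
  They are taken with multiplicity, so the list has \<open>dim_col A\<close> entries. For a wide
  matrix it therefore ends in additional zeros, which do not affect the largest entry.\<close>

definition singular_values :: "complex mat \<Rightarrow> real list" where
  "singular_values A =
     rev (sorted_list_of_multiset
       (image_mset (\<lambda>z. sqrt (Re z)) (proots (char_poly (mat_adjoint A * A)))))"

text \<open>The index starts at 1.\<close>

definition sigma :: "nat \<Rightarrow> complex mat \<Rightarrow> real" where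
  "sigma i A = singular_values A ! (i - 1)"

definition norm2_mat :: "complex mat \<Rightarrow> real" where
  "norm2_mat A = sigma 1 A"

text \<open>Matrix indices start at 0, hence the shift by \<open>Suc\<close>.\<close>

definition Sigma_mat :: "nat \<Rightarrow> complex mat \<Rightarrow> complex mat" where
  "Sigma_mat s A = mat_diag s (\<lambda>j. complex_of_real (sigma (Suc j) A))"

definition Sigma_inv_sqrt :: "nat \<Rightarrow> complex mat \<Rightarrow> complex mat" where
  "Sigma_inv_sqrt s A = mat_diag s (\<lambda>j. complex_of_real (sigma (Suc j) A powr (- 1 / 2)))"

definition thin_svd :: "complex mat \<Rightarrow> complex mat \<Rightarrow> complex mat \<Rightarrow> bool" where
  "thin_svd A U V \<longleftrightarrow>
     (let m = dim_row A; n = dim_col A in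
        U \<in> carrier_mat m n \<and> mat_adjoint U * U = 1\<^sub>m n \<and>
        V \<in> carrier_mat n n \<and> mat_adjoint V * V = 1\<^sub>m n \<and> V * mat_adjoint V = 1\<^sub>m n \<and>
        A = U * Sigma_mat n A * mat_adjoint V)"

definition first_cols :: "nat \<Rightarrow> complex mat \<Rightarrow> complex mat" where
  "first_cols r M = mat_of_cols (dim_row M) (take r (cols M))"

definition S_plus :: "nat \<Rightarrow> complex mat \<Rightarrow> complex mat \<Rightarrow> complex mat \<Rightarrow> complex mat" where
  "S_plus r A U V = first_cols r V * Sigma_inv_sqrt r A * mat_adjoint (first_cols r U)"

lemma length_singular_values: "length (singular_values A) = dim_col A"
proof -
  have "mat_adjoint A * A \<in> carrier_mat (dim_col A) (dim_col A)"
    by (auto simp: mat_adjoint_def)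
  then have "degree (char_poly (mat_adjoint A * A)) = dim_col A"
    using degree_monic_char_poly by blast
  moreover have "length (sorted_list_of_multiset M) = size M" for M :: "real multiset"
    by (metis mset_sorted_list_of_multiset size_mset)
  ultimately show ?thesis
    by (simp add: singular_values_def size_proots_complex)
qed

lemma sigma_antimono:
  assumes "1 \<le> i" "i \<le> j" "j \<le> dim_col A"
  shows "sigma j A \<le> sigma i A"
proof -
  have "sorted (rev (singular_values A))"
    by (simp add: singular_values_def)
  then show ?thesis
    using assms by (simp add: sigma_def sorted_rev_iff_nth_mono length_singular_values)
qed

end

theory Submission
  imports Defs "HOL-Analysis.L2_Norm"
begin

text \<open>The first \<open>r\<close> singular vectors compress \<open>A\<close> to \<open>U\<^sub>r\<^sup>* A V\<^sub>r = \<Sigma>\<^sub>r\<close>, which is positive because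
  \<open>r\<close> is the rank. Hence \<open>B = A + E\<close> is compressed to
  \<open>M = U\<^sub>r\<^sup>* B V\<^sub>r = \<Sigma>\<^sub>r\<^sup>1\<^sup>/\<^sup>2 (1 + K) \<Sigma>\<^sub>r\<^sup>1\<^sup>/\<^sup>2\<close> with
  \<open>K = \<Sigma>\<^sub>r\<^sup>-\<^sup>1\<^sup>/\<^sup>2 U\<^sub>r\<^sup>* E V\<^sub>r \<Sigma>\<^sub>r\<^sup>-\<^sup>1\<^sup>/\<^sup>2\<close>. Since \<open>S\<^sup>+ E S\<^sup>+ = V\<^sub>r K U\<^sub>r\<^sup>*\<close>, the number \<open>k\<close> bounds the norm
  of \<open>K\<close>.

  For the lower bound, take \<open>y\<close> in the span of the first \<open>i\<close> coordinate vectors and put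
  \<open>z = \<Sigma>\<^sub>r\<^sup>1\<^sup>/\<^sup>2 y\<close>. Then \<open>\<parallel>B V\<^sub>r y\<parallel> \<parallel>y\<parallel>\<close> is at least the real part of the quadratic form of \<open>M\<close> at
  \<open>y\<close>, which is the one of \<open>1 + K\<close> at \<open>z\<close> and therefore at least
  \<open>(1 - k) \<parallel>z\<parallel>\<^sup>2 \<ge> (1 - k) \<sigma>\<^sub>i(A) \<parallel>y\<parallel>\<^sup>2\<close>. The Courant-Fischer principle (\<open>sigma_witness_le\<close>)
  finishes the argument in \<open>sigma_lower\<close>.

  The upper bound is this argument for the inverse of \<open>M\<close>, phrased so that \<open>M\<close> may be
  singular. The key is \<open>contraction_perturbation\<close>: for \<open>k \<le> 1\<close>,
  \<open>\<parallel>(1 + K) z\<parallel>\<^sup>2 \<le> (1 + k) Re ((1 + K) z \<bullet>c z)\<close>. If \<open>B V\<^sub>r w = U\<^sub>r v\<close> and the first \<open>i - 1\<close> entries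
  of \<open>v\<close> vanish, it yields \<open>\<parallel>v\<parallel> \<le> (1 + k) \<sigma>\<^sub>i(A) \<parallel>w\<parallel>\<close> (\<open>preimage_bound\<close>). Such \<open>w\<close> form a space of
  dimension at least \<open>2 r - m - i + 1\<close>, and \<open>sigma_witness_ge\<close> turns this into the bound for
  the singular value with index \<open>m + n - 2 r + i\<close> (\<open>sigma_upper\<close>).

  The variational bounds rest on a basis of right singular vectors that matches the
  singular values with their multiplicities; \<open>right_singular_basis\<close> obtains it from a unitary
  triangularization of \<open>B\<^sup>* B\<close>.\<close>

section \<open>Adjoints, inner products and norms\<close>

lemma mat_adjoint_carrier [simp]:
  "A \<in> carrier_mat m n \<Longrightarrow> mat_adjoint A \<in> carrier_mat n m"
  by (auto simp: mat_adjoint_def)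

lemma mult_mat_vec_carrier_vec [simp]:
  "A \<in> carrier_mat m n \<Longrightarrow> A *\<^sub>v v \<in> carrier_vec m"
  by (auto intro: carrier_vecI)

lemma mat_adjoint_dim [simp]:
  "dim_row (mat_adjoint A) = dim_col A" "dim_col (mat_adjoint A) = dim_row A"
  by (auto simp: mat_adjoint_def)

lemma mat_adjoint_index [simp]:
  fixes A :: "complex mat"
  assumes "i < dim_col A" "j < dim_row A"
  shows "mat_adjoint A $$ (i, j) = cnj (A $$ (j, i))"
  using assms by (simp add: mat_adjoint_def mat_of_rows_def)

lemma mat_adjoint_adjoint [simp]: "mat_adjoint (mat_adjoint A) = (A :: complex mat)"
  by (rule eq_matI) auto

lemma mat_adjoint_mult:
  fixes A B :: "complex mat"
  assumes "A \<in> carrier_mat m n" "B \<in> carrier_mat n p"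
  shows "mat_adjoint (A * B) = mat_adjoint B * mat_adjoint A"
  using assms by (intro eq_matI) (auto simp: scalar_prod_def mult.commute)

lemma cscalar_prod_mult_mat_vec:
  fixes A :: "complex mat"
  assumes "A \<in> carrier_mat m n" "v \<in> carrier_vec n" "w \<in> carrier_vec m"
  shows "(A *\<^sub>v v) \<bullet>c w = v \<bullet>c (mat_adjoint A *\<^sub>v w)"
proof -
  have "(A *\<^sub>v v) \<bullet>c w = (\<Sum>i<m. \<Sum>j<n. A $$ (i, j) * v $ j * cnj (w $ i))"
    using assms by (auto simp: scalar_prod_def lessThan_atLeast0 sum_distrib_right intro!: sum.cong)
  also have "\<dots> = (\<Sum>j<n. \<Sum>i<m. A $$ (i, j) * v $ j * cnj (w $ i))"
    by (rule sum.swap)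
  also have "\<dots> = v \<bullet>c (mat_adjoint A *\<^sub>v w)"
    using assms by (auto simp: scalar_prod_def lessThan_atLeast0 sum_distrib_left mult_ac
        intro!: sum.cong)
  finally show ?thesis .
qed

lemma cscalar_prod_commute:
  fixes v w :: "complex vec"
  assumes "dim_vec v = dim_vec w"
  shows "v \<bullet>c w = cnj (w \<bullet>c v)"
  using assms by (simp add: scalar_prod_def mult.commute)

definition vec_norm :: "complex vec \<Rightarrow> real" where
  "vec_norm v = L2_set (\<lambda>i. cmod (v $ i)) {..<dim_vec v}"

lemma vec_norm_nonneg [simp]: "0 \<le> vec_norm v"
  by (simp add: vec_norm_def)

lemma vec_norm_power2: "vec_norm v ^ 2 = (\<Sum>i<dim_vec v. cmod (v $ i) ^ 2)"
  by (simp add: vec_norm_def L2_set_def sum_nonneg)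

lemma cscalar_prod_self: "v \<bullet>c v = complex_of_real (vec_norm v ^ 2)"
  by (simp only: vec_norm_power2 scalar_prod_def)
     (auto simp: complex_norm_square[symmetric] lessThan_atLeast0 intro!: sum.cong)

lemma vec_norm_smult: "vec_norm (a \<cdot>\<^sub>v v) = cmod a * vec_norm v"
  by (auto simp: vec_norm_def L2_set_right_distrib norm_mult intro!: L2_set_cong)

lemma vec_norm_pos_iff:
  assumes "v \<in> carrier_vec n"
  shows "0 < vec_norm v \<longleftrightarrow> v \<noteq> 0\<^sub>v n"
proof -
  have "vec_norm v = 0 \<longleftrightarrow> v = 0\<^sub>v n"
    using assms by (auto simp: vec_norm_def L2_set_eq_0_iff)
  then show ?thesis
    using vec_norm_nonneg[of v] by linarith
qed

lemma cauchy_schwarz_vec: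
  assumes "v \<in> carrier_vec n" "w \<in> carrier_vec n"
  shows "cmod (v \<bullet>c w) \<le> vec_norm v * vec_norm w"
proof -
  have "cmod (v \<bullet>c w) \<le> (\<Sum>i<n. \<bar>cmod (v $ i)\<bar> * \<bar>cmod (w $ i)\<bar>)"
    using assms by (auto simp: scalar_prod_def lessThan_atLeast0 norm_mult intro!: sum_norm_le)
  also have "\<dots> \<le> vec_norm v * vec_norm w"
    using assms L2_set_mult_ineq[of "\<lambda>i. cmod (v $ i)" "\<lambda>i. cmod (w $ i)" "{..<n}"]
    by (simp add: vec_norm_def)
  finally show ?thesis .
qed

lemma cscalar_prod_isometry:
  fixes X :: "complex mat"
  assumes "X \<in> carrier_mat n p" "mat_adjoint X * X = 1\<^sub>m p"
    and "v \<in> carrier_vec p" "w \<in> carrier_vec p"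
  shows "(X *\<^sub>v v) \<bullet>c (X *\<^sub>v w) = v \<bullet>c w"
proof -
  have "mat_adjoint X *\<^sub>v (X *\<^sub>v w) = w"
    using assms by (simp flip: assoc_mult_mat_vec[of _ p n _ p])
  then show ?thesis
    using assms cscalar_prod_mult_mat_vec[of X n p v "X *\<^sub>v w"] by simp
qed

lemma vec_norm_isometry:
  assumes "X \<in> carrier_mat n p" "mat_adjoint X * X = 1\<^sub>m p" "v \<in> carrier_vec p"
  shows "vec_norm (X *\<^sub>v v) = vec_norm v"
proof -
  have "complex_of_real (vec_norm (X *\<^sub>v v) ^ 2) = complex_of_real (vec_norm v ^ 2)"
    using cscalar_prod_isometry[OF assms(1,2,3,3)] by (simp only: cscalar_prod_self)
  then have "vec_norm (X *\<^sub>v v) ^ 2 = vec_norm v ^ 2"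
    by (simp only: of_real_eq_iff)
  then show ?thesis
    by (simp add: power2_eq_iff_nonneg)
qed

section \<open>Homogeneous linear systems\<close>

text \<open>Padding the coefficient matrix with zero rows to a square matrix makes its determinant
  vanish. The dimension counts below are carried out through this lemma and the next one,
  so that no bases of intersections of subspaces have to be constructed.\<close>

lemma nontrivial_solution:
  fixes C :: "'a :: field mat"
  assumes C: "C \<in> carrier_mat q p" and "q < p"
  obtains y where "y \<in> carrier_vec p" "y \<noteq> 0\<^sub>v p" "C *\<^sub>v y = 0\<^sub>v q"
proof -
  define Z where "Z = mat\<^sub>r p p (\<lambda>i. if i = q then 0\<^sub>v p else if i < q then row C i else 0\<^sub>v p)"
  have Z: "Z \<in> carrier_mat p p" by (simp add: Z_def)
  have "det Z = 0"
    unfolding Z_def using assms by (intro det_row_0) auto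
  then obtain y where y: "y \<in> carrier_vec p" "y \<noteq> 0\<^sub>v p" "Z *\<^sub>v y = 0\<^sub>v p"
    using det_0_iff_vec_prod_zero_field[OF Z] by auto
  have "C *\<^sub>v y = 0\<^sub>v q"
  proof (rule eq_vecI)
    fix i assume "i < dim_vec (0\<^sub>v q :: 'a vec)"
    then have i: "i < q" "i < p" using assms by auto
    have "(Z *\<^sub>v y) $ i = row Z i \<bullet> y" using i Z by simp
    moreover have "row Z i = row C i" using i C by (simp add: Z_def)
    ultimately show "(C *\<^sub>v y) $ i = 0\<^sub>v q $ i" using i C y(3) by simp
  qed (use C in simp)
  with y that show thesis by blast
qed

text \<open>The window of rows of \<open>D\<close> is there to select the coordinates with respect to a singular
  basis that are forced to vanish, on top of the constraints \<open>C\<close> of the subspace at hand.\<close>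

lemma common_nontrivial_solution:
  fixes C D :: "'a :: field mat"
  assumes C: "C \<in> carrier_mat q p" and D: "D \<in> carrier_mat d p" and "s + t \<le> d" "q + t < p"
  obtains y where "y \<in> carrier_vec p" "y \<noteq> 0\<^sub>v p" "C *\<^sub>v y = 0\<^sub>v q"
    "\<And>l. s \<le> l \<Longrightarrow> l < s + t \<Longrightarrow> (D *\<^sub>v y) $ l = 0"
proof -
  define Z where "Z = mat\<^sub>r (q + t) p (\<lambda>l. if l < q then row C l else row D (s + (l - q)))"
  have Z: "Z \<in> carrier_mat (q + t) p" by (simp add: Z_def)
  obtain y where y: "y \<in> carrier_vec p" "y \<noteq> 0\<^sub>v p" and Zy: "Z *\<^sub>v y = 0\<^sub>v (q + t)"
    using nontrivial_solution[OF Z \<open>q + t < p\<close>] by blast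
  have rows: "(if l < q then row C l else row D (s + (l - q))) \<bullet> y = 0" if "l < q + t" for l
  proof -
    have "row Z l = (if l < q then row C l else row D (s + (l - q)))"
      unfolding Z_def by (rule row_mat_of_row_fun) (use that assms in auto)
    then show ?thesis
      using arg_cong[OF Zy, of "\<lambda>v. v $ l"] that Z by simp
  qed
  have "C *\<^sub>v y = 0\<^sub>v q"
  proof (rule eq_vecI)
    fix i assume "i < dim_vec (0\<^sub>v q :: 'a vec)"
    then show "(C *\<^sub>v y) $ i = 0\<^sub>v q $ i" using rows[of i] C by simp
  qed (use C in simp)
  moreover have "(D *\<^sub>v y) $ l = 0" if "s \<le> l" "l < s + t" for l
  proof -
    have "q + (l - s) < q + t" "\<not> q + (l - s) < q" "s + (q + (l - s) - q) = l"
      using that by auto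
    then have "row D l \<bullet> y = 0"
      using rows[of "q + (l - s)"] by (simp only: if_False)
    then show ?thesis
      using that D \<open>s + t \<le> d\<close> by simp
  qed
  ultimately show thesis using that y by blast
qed

section \<open>Unitary triangularization and right singular vectors\<close>

text \<open>Sorting a list of the eigenvalues themselves by the square root of their real part
  gives an enumeration that a Schur decomposition can be asked to put on its diagonal.\<close>

lemma singular_values_eigenvalues:
  fixes B :: "complex mat"
  obtains es where "mset es = proots (char_poly (mat_adjoint B * B))"
    and "singular_values B = map (\<lambda>z. sqrt (Re z)) es"
proof -
  obtain es' where es': "mset es' = proots (char_poly (mat_adjoint B * B))"
    using ex_mset by blast
  define es where "es = rev (sort_key (\<lambda>z. sqrt (Re z)) es')"
  have "sorted_list_of_multiset (image_mset (\<lambda>z. sqrt (Re z)) (mset es')) =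
      map (\<lambda>z. sqrt (Re z)) (sort_key (\<lambda>z. sqrt (Re z)) es')"
    by (metis mset_map mset_sort sorted_list_of_multiset_mset sorted_sort_id
        sorted_sort_key)
  then have "singular_values B = map (\<lambda>z. sqrt (Re z)) es"
    by (simp add: singular_values_def es_def rev_map flip: es')
  moreover have "mset es = proots (char_poly (mat_adjoint B * B))"
    by (simp add: es_def es')
  ultimately show thesis using that by blast
qed

lemma mult_upper_triangular:
  fixes A B :: "complex mat"
  assumes A: "A \<in> carrier_mat n n" and B: "B \<in> carrier_mat n n"
    and utA: "upper_triangular A" and utB: "upper_triangular B"
  shows "upper_triangular (A * B)"
    and "i < n \<Longrightarrow> (A * B) $$ (i, i) = A $$ (i, i) * B $$ (i, i)"
proof -
  have entry: "(A * B) $$ (i, j) = (\<Sum>l<n. A $$ (i, l) * B $$ (l, j))" if "i < n" "j < n" for i j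
    using that A B by (auto simp: scalar_prod_def lessThan_atLeast0 intro!: sum.cong)
  show "upper_triangular (A * B)"
    unfolding upper_triangular_def
  proof (intro allI impI)
    fix i j assume ij: "i < dim_row (A * B)" "j < i"
    have "A $$ (i, l) * B $$ (l, j) = 0" if "l < n" for l
      using utA utB A B ij that
      by (cases "l < i") (auto simp: upper_triangular_def)
    then show "(A * B) $$ (i, j) = 0"
      using ij A B by (subst entry) (auto intro!: sum.neutral)
  qed
  show "(A * B) $$ (i, i) = A $$ (i, i) * B $$ (i, i)" if "i < n"
  proof -
    have "A $$ (i, l) * B $$ (l, i) = (if l = i then A $$ (i, i) * B $$ (i, i) else 0)"
      if "l < n" for l
      using utA utB A B \<open>i < n\<close> that
      by (cases l i rule: linorder_cases) (auto simp: upper_triangular_def)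
    then have "(A * B) $$ (i, i) = (\<Sum>l<n. if l = i then A $$ (i, i) * B $$ (i, i) else 0)"
      unfolding entry[OF that that] by (intro sum.cong) auto
    then show ?thesis
      using that by simp
  qed
qed

text \<open>This is the QR factorization of an injective matrix, obtained without an iteration:
  column \<open>j\<close> of \<open>Y\<close> is a combination of the first \<open>j + 1\<close> columns of \<open>P\<close> that is orthogonal
  to the \<open>j\<close> preceding columns of \<open>P\<close>. It exists because there are more unknowns than
  equations. It is then also orthogonal to the preceding columns of \<open>P * Y\<close>, which are
  combinations of the preceding columns of \<open>P\<close>.\<close>

lemma triangular_orthonormalization:
  fixes P :: "complex mat"
  assumes P: "P \<in> carrier_mat n n"
    and inj: "\<And>y. y \<in> carrier_vec n \<Longrightarrow> y \<noteq> 0\<^sub>v n \<Longrightarrow> P *\<^sub>v y \<noteq> 0\<^sub>v n"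
  obtains Y where "Y \<in> carrier_mat n n" "upper_triangular Y"
    "mat_adjoint (P * Y) * (P * Y) = 1\<^sub>m n" "upper_triangular (mat_adjoint (P * Y) * P)"
proof -
  define G where "G = mat_adjoint P * P"
  have G: "G \<in> carrier_mat n n" using P by (simp add: G_def mult_carrier_mat[of _ n n])
  have "\<exists>z. z \<in> carrier_vec n \<and> vec_norm (P *\<^sub>v z) = 1 \<and>
      (\<forall>l<n. j < l \<longrightarrow> z $ l = 0) \<and> (\<forall>l<j. (G *\<^sub>v z) $ l = 0)" if j: "j < n" for j
  proof -
    \<comment> \<open>The first \<open>j\<close> equations express orthogonality; the remaining ones remove the
      coefficients with index greater than \<open>j\<close>.\<close>
    define C where
      "C = mat\<^sub>r (n - 1) n (\<lambda>l. if l < j then row G l else unit_vec n (Suc l))"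
    have C: "C \<in> carrier_mat (n - 1) n" by (simp add: C_def)
    obtain y where y: "y \<in> carrier_vec n" "y \<noteq> 0\<^sub>v n" "C *\<^sub>v y = 0\<^sub>v (n - 1)"
      using nontrivial_solution[OF C] j by auto
    have Cy: "row C l \<bullet> y = 0" if "l < n - 1" for l
      using arg_cong[OF y(3), of "\<lambda>v. v $ l"] that C by simp
    have rowC: "row C l = (if l < j then row G l else unit_vec n (Suc l))" if "l < n - 1" for l
      using that G by (auto simp: C_def)
    \<comment> \<open>The row that removes the coefficient \<open>l\<close> has index \<open>l - 1\<close>.\<close>
    have y0: "y $ l = 0" if "l < n" "j < l" for l
    proof -
      have "l - 1 < n - 1" "\<not> l - 1 < j" "Suc (l - 1) = l"
        using that by auto
      then have "row C (l - 1) = unit_vec n l"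
        by (simp only: rowC if_False)
      then show ?thesis using Cy[of "l - 1"] that y(1) by simp
    qed
    have Gy: "(G *\<^sub>v y) $ l = 0" if "l < j" for l
    proof -
      have "row C l = row G l"
        using rowC[of l] that j by (simp only: if_True)
      then show ?thesis using Cy[of l] that j G by simp
    qed
    define z where "z = complex_of_real (1 / vec_norm (P *\<^sub>v y)) \<cdot>\<^sub>v y"
    have pos: "0 < vec_norm (P *\<^sub>v y)"
      using inj[OF y(1,2)] P y(1) by (subst vec_norm_pos_iff[of _ n]) auto
    have "vec_norm (P *\<^sub>v z) = 1"
    proof -
      have "P *\<^sub>v z = complex_of_real (1 / vec_norm (P *\<^sub>v y)) \<cdot>\<^sub>v (P *\<^sub>v y)"
        unfolding z_def using P y(1) by (rule mult_mat_vec)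
      then have "vec_norm (P *\<^sub>v z) = (1 / vec_norm (P *\<^sub>v y)) * vec_norm (P *\<^sub>v y)"
        by (simp only: vec_norm_smult norm_of_real) simp
      then show ?thesis using pos by simp
    qed
    moreover have "G *\<^sub>v z = complex_of_real (1 / vec_norm (P *\<^sub>v y)) \<cdot>\<^sub>v (G *\<^sub>v y)"
      unfolding z_def using G y(1) by (rule mult_mat_vec)
    ultimately show ?thesis
      using y0 Gy y(1) j G by (intro exI[of _ z]) (auto simp: z_def)
  qed
  then obtain z where z: "\<And>j. j < n \<Longrightarrow> z j \<in> carrier_vec n"
    and z1: "\<And>j. j < n \<Longrightarrow> vec_norm (P *\<^sub>v z j) = 1"
    and z0: "\<And>j l. j < n \<Longrightarrow> l < n \<Longrightarrow> j < l \<Longrightarrow> z j $ l = 0"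
    and Gz: "\<And>j l. j < n \<Longrightarrow> l < j \<Longrightarrow> (G *\<^sub>v z j) $ l = 0"
    by metis
  define Y where "Y = mat n n (\<lambda>(i, j). z j $ i)"
  have Y: "Y \<in> carrier_mat n n" by (simp add: Y_def)
  have colY: "col Y j = z j" if "j < n" for j
    using that z[OF that] by (auto simp: Y_def)
  have utY: "upper_triangular Y"
    using z0 by (auto simp: upper_triangular_def Y_def)
  define F where "F = mat_adjoint (P * Y) * P"
  have F: "F \<in> carrier_mat n n" and PY: "P * Y \<in> carrier_mat n n"
    using P Y by (auto simp: F_def mult_carrier_mat[of _ n n])
  have adjF: "mat_adjoint F = G * Y"
  proof -
    have "mat_adjoint F = mat_adjoint P * (P * Y)"
      unfolding F_def using P PY by (simp add: mat_adjoint_mult[of "mat_adjoint (P * Y)" n n P n])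
    then show ?thesis
      using P Y by (simp add: G_def assoc_mult_mat[of _ n n _ n _ n])
  qed
  have utF: "upper_triangular F"
    unfolding upper_triangular_def
  proof (intro allI impI)
    fix i j assume "i < dim_row F" "j < i"
    then have ij: "i < n" "j < n" "j < i" using F by auto
    have "mat_adjoint F $$ (j, i) = (G *\<^sub>v z i) $ j"
      using ij G Y by (simp add: adjF flip: colY[OF ij(1)])
    then show "F $$ (i, j) = 0"
      using Gz[of i j] ij F by simp
  qed
  have FY: "F * Y = mat_adjoint (P * Y) * (P * Y)"
    unfolding F_def using P Y by (intro assoc_mult_mat[of _ n n _ n _ n]) auto
  have entry: "(F * Y) $$ (i, j) = (P *\<^sub>v z j) \<bullet>c (P *\<^sub>v z i)" if "i < n" "j < n" for i j
  proof -
    have "(F * Y) $$ (i, j) = row (mat_adjoint (P * Y)) i \<bullet> col (P * Y) j"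
      unfolding FY using that P Y by simp
    also have "row (mat_adjoint (P * Y)) i = conjugate (col (P * Y) i)"
      using that P Y by (intro eq_vecI) auto
    also have "conjugate (col (P * Y) i) \<bullet> col (P * Y) j = col (P * Y) j \<bullet>c col (P * Y) i"
      by (rule conjugate_vec_sprod_comm[symmetric, of _ n]) (use that P Y in auto)
    also have "\<dots> = (P *\<^sub>v z j) \<bullet>c (P *\<^sub>v z i)"
      using that P Y by (simp only: col_mult2[of _ n n] colY)
    finally show ?thesis .
  qed
  have "F * Y = 1\<^sub>m n"
  proof (rule eq_matI)
    fix i j assume "i < dim_row (1\<^sub>m n :: complex mat)" "j < dim_col (1\<^sub>m n :: complex mat)"
    then have ij: "i < n" "j < n" by auto
    have low: "(F * Y) $$ (a, b) = 0" if "a < n" "b < a" for a b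
      using mult_upper_triangular(1)[OF F Y utF utY] that F by (auto simp: upper_triangular_def)
    show "(F * Y) $$ (i, j) = 1\<^sub>m n $$ (i, j)"
    proof (cases i j rule: linorder_cases)
      case less
      have "(F * Y) $$ (i, j) = cnj ((F * Y) $$ (j, i))"
        unfolding entry[OF ij] entry[OF ij(2,1)]
        by (rule cscalar_prod_commute) (use P in auto)
      then show ?thesis using low[of j i] less ij by simp
    next
      case equal
      then show ?thesis using entry[OF ij] z1[OF ij(1)] ij by (simp only: cscalar_prod_self) simp
    next
      case greater
      then show ?thesis using low[of i j] ij by simp
    qed
  qed (use F Y in auto)
  then have "mat_adjoint (P * Y) * (P * Y) = 1\<^sub>m n"
    by (simp only: FY)
  from that[OF Y utY this utF[unfolded F_def]] show thesis .
qed

text \<open>The Schur decomposition \<open>A = P * T * Q\<close> has a transformation that is invertible but not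
  unitary. After orthonormalizing \<open>W = P * Y\<close>, the factor \<open>F = W\<^sup>* P\<close> is upper triangular
  and inverse to \<open>Y\<close>, so that \<open>W\<^sup>* A W = F * T * Y\<close> stays upper triangular with the
  diagonal of \<open>T\<close>.\<close>

lemma unitary_schur_decomposition:
  fixes A :: "complex mat"
  assumes A: "A \<in> carrier_mat n n" and cp: "char_poly A = (\<Prod>e\<leftarrow>es. [:- e, 1:])"
  obtains W where "W \<in> carrier_mat n n" "mat_adjoint W * W = 1\<^sub>m n"
    "upper_triangular (mat_adjoint W * A * W)"
    "\<And>i. i < n \<Longrightarrow> (mat_adjoint W * A * W) $$ (i, i) = es ! i"
proof -
  obtain T P Q where TPQ: "schur_decomposition A es = (T, P, Q)"
    by (cases "schur_decomposition A es")
  note schur = schur_decomposition[OF A cp TPQ]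
  have T: "T \<in> carrier_mat n n" and P: "P \<in> carrier_mat n n" and Q: "Q \<in> carrier_mat n n"
    and QP: "Q * P = 1\<^sub>m n" and APTQ: "A = P * T * Q"
    using schur A by (auto simp: similar_mat_wit_def Let_def)
  have utT: "upper_triangular T" and diag: "\<And>i. i < n \<Longrightarrow> T $$ (i, i) = es ! i"
    using schur T by (auto simp: diag_mat_def)
  have inj: "P *\<^sub>v y \<noteq> 0\<^sub>v n" if "y \<in> carrier_vec n" "y \<noteq> 0\<^sub>v n" for y
  proof
    assume "P *\<^sub>v y = 0\<^sub>v n"
    then have "Q *\<^sub>v (P *\<^sub>v y) = 0\<^sub>v n" using Q by (auto simp: scalar_prod_def)
    then show False using that Q P QP by (simp flip: assoc_mult_mat_vec[of _ n n _ n])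
  qed
  obtain Y where Y: "Y \<in> carrier_mat n n" and utY: "upper_triangular Y"
    and orth: "mat_adjoint (P * Y) * (P * Y) = 1\<^sub>m n"
    and utF: "upper_triangular (mat_adjoint (P * Y) * P)"
    using triangular_orthonormalization[OF P inj] by blast
  define W where "W = P * Y"
  define F where "F = mat_adjoint W * P"
  have W: "W \<in> carrier_mat n n" and F: "F \<in> carrier_mat n n"
    using P Y by (auto simp: W_def F_def mult_carrier_mat[of _ n n])
  have W': "mat_adjoint W \<in> carrier_mat n n" using W by simp
  have FY: "F * Y = 1\<^sub>m n"
    using orth W' P Y by (simp add: F_def W_def assoc_mult_mat[of _ n n _ n _ n])
  have "mat_adjoint W * A * W = mat_adjoint W * (P * T * (Q * P * Y))"
    unfolding APTQ using W' P T Q Y by (simp add: W_def assoc_mult_mat[of _ n n _ n _ n] mult_carrier_mat[of _ n n])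
  also have "\<dots> = F * T * Y"
    using W' P T Y unfolding QP by (simp add: F_def assoc_mult_mat[of _ n n _ n _ n] mult_carrier_mat[of _ n n])
  finally have eq: "mat_adjoint W * A * W = F * T * Y" .
  have FT: "F * T \<in> carrier_mat n n" using F T by simp
  have utF': "upper_triangular F" using utF by (simp add: F_def W_def)
  note utFT = mult_upper_triangular[OF F T utF' utT]
  note utFTY = mult_upper_triangular[OF FT Y utFT(1) utY]
  have "(F * T * Y) $$ (i, i) = es ! i" if i: "i < n" for i
  proof -
    have "F $$ (i, i) * Y $$ (i, i) = 1"
      using mult_upper_triangular(2)[OF F Y utF' utY i] FY i by simp
    moreover have "(F * T * Y) $$ (i, i) = (F $$ (i, i) * Y $$ (i, i)) * T $$ (i, i)"
      using utFTY(2)[OF i] utFT(2)[OF i] by simp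
    ultimately show ?thesis using diag[OF i] by simp
  qed
  with utFTY(1) show thesis
    by (intro that[OF W orth[folded W_def]]) (simp_all only: eq)
qed

text \<open>A unitary triangularization of \<open>B\<^sup>* B\<close> is Hermitian and hence diagonal. Evaluating the
  resulting quadratic form at unit vectors shows that the eigenvalues are real and
  nonnegative, so that they are the squares of the singular values.\<close>

lemma right_singular_basis:
  fixes B :: "complex mat"
  assumes B: "B \<in> carrier_mat m n"
  obtains W where "W \<in> carrier_mat n n" "mat_adjoint W * W = 1\<^sub>m n"
    and "\<And>c. c \<in> carrier_vec n \<Longrightarrow>
      vec_norm (B *\<^sub>v (W *\<^sub>v c)) ^ 2 = (\<Sum>j<n. sigma (Suc j) B ^ 2 * cmod (c $ j) ^ 2)"
    and "\<And>j. j < n \<Longrightarrow> 0 \<le> sigma (Suc j) B"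
proof -
  define H where "H = mat_adjoint B * B"
  have H: "H \<in> carrier_mat n n"
    using B by (simp add: H_def mult_carrier_mat[of _ n m])
  obtain es where es: "mset es = proots (char_poly H)"
    and sv: "singular_values B = map (\<lambda>z. sqrt (Re z)) es"
    unfolding H_def by (rule singular_values_eigenvalues)
  have len: "length es = n"
    using arg_cong[OF sv, of length] B by (simp add: length_singular_values)
  have "char_poly H = (\<Prod>x\<in>#proots (char_poly H). [:- x, 1:])"
    using complex_poly_decompose_multiset[of "char_poly H"] degree_monic_char_poly[OF H] by simp
  also have "\<dots> = (\<Prod>e\<leftarrow>es. [:- e, 1:])"
    by (simp flip: es prod_mset_prod_list)
  finally have cp: "char_poly H = (\<Prod>e\<leftarrow>es. [:- e, 1:])" .
  obtain W where W: "W \<in> carrier_mat n n" and WW: "mat_adjoint W * W = 1\<^sub>m n"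
    and ut: "upper_triangular (mat_adjoint W * H * W)"
    and diag: "\<And>i. i < n \<Longrightarrow> (mat_adjoint W * H * W) $$ (i, i) = es ! i"
    using unitary_schur_decomposition[OF H cp] by blast
  define M where "M = mat_adjoint W * H * W"
  have M: "M \<in> carrier_mat n n" using W H by (simp add: M_def mult_carrier_mat[of _ n n])
  have BW: "B * W \<in> carrier_mat m n" using B W by simp
  have M_eq: "M = mat_adjoint (B * W) * (B * W)"
    using B W by (simp add: M_def H_def mat_adjoint_mult[of _ m n _ n]
        assoc_mult_mat[of _ n n _ m _ n] assoc_mult_mat[of _ n m _ n _ n]
        assoc_mult_mat[of _ n n _ n _ n] mult_carrier_mat[of _ n m])
  have herm: "mat_adjoint M = M"
    using BW by (simp add: M_eq mat_adjoint_mult[of _ n m _ n])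
  have off: "M $$ (i, j) = 0" if "i < n" "j < n" "i \<noteq> j" for i j
  proof -
    have low: "M $$ (a, b) = 0" if "a < n" "b < a" for a b
      using ut that M by (auto simp: M_def upper_triangular_def)
    have "M $$ (i, j) = cnj (M $$ (j, i))"
      using arg_cong[OF herm, of "\<lambda>X. X $$ (i, j)"] that M by simp
    then show ?thesis
      using low[of i j] low[of j i] that by (cases "j < i") auto
  qed
  have form: "complex_of_real (vec_norm (B *\<^sub>v (W *\<^sub>v c)) ^ 2) =
      (\<Sum>j<n. cnj (es ! j) * complex_of_real (cmod (c $ j) ^ 2))" if c: "c \<in> carrier_vec n" for c
  proof -
    have BWc: "B *\<^sub>v (W *\<^sub>v c) = (B * W) *\<^sub>v c" using B W c by simp
    have "complex_of_real (vec_norm (B *\<^sub>v (W *\<^sub>v c)) ^ 2) = ((B * W) *\<^sub>v c) \<bullet>c ((B * W) *\<^sub>v c)"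
      by (simp only: BWc cscalar_prod_self)
    also have "\<dots> = c \<bullet>c (mat_adjoint (B * W) *\<^sub>v ((B * W) *\<^sub>v c))"
      using BW c by (intro cscalar_prod_mult_mat_vec[of _ m n]) auto
    also have "mat_adjoint (B * W) *\<^sub>v ((B * W) *\<^sub>v c) = M *\<^sub>v c"
      unfolding M_eq using BW c by (simp flip: assoc_mult_mat_vec[of _ n m _ n])
    also have "M *\<^sub>v c = vec n (\<lambda>j. es ! j * c $ j)"
    proof (rule eq_vecI)
      fix i assume "i < dim_vec (vec n (\<lambda>j. es ! j * c $ j))"
      then have i: "i < n" by simp
      have "(M *\<^sub>v c) $ i = (\<Sum>j<n. M $$ (i, j) * c $ j)"
        using i M c by (auto simp: scalar_prod_def lessThan_atLeast0 intro!: sum.cong)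
      also have "\<dots> = (\<Sum>j<n. if j = i then es ! i * c $ i else 0)"
        using off i diag by (intro sum.cong) (auto simp: M_def)
      finally show "(M *\<^sub>v c) $ i = vec n (\<lambda>j. es ! j * c $ j) $ i"
        using i by simp
    qed (use M in simp)
    also have "c \<bullet>c vec n (\<lambda>j. es ! j * c $ j) = (\<Sum>j<n. c $ j * cnj (es ! j * c $ j))"
      using c by (auto simp: scalar_prod_def lessThan_atLeast0 intro!: sum.cong)
    also have "\<dots> = (\<Sum>j<n. cnj (es ! j) * complex_of_real (cmod (c $ j) ^ 2))"
      by (simp only: complex_norm_square complex_cnj_mult mult_ac)
    finally show ?thesis .
  qed
  have sig: "sigma (Suc j) B ^ 2 = Re (es ! j) \<and> 0 \<le> sigma (Suc j) B" if j: "j < n" for j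
  proof -
    have "complex_of_real (vec_norm (B *\<^sub>v (W *\<^sub>v unit_vec n j)) ^ 2) =
      (\<Sum>l<n. cnj (es ! l) * complex_of_real (cmod (unit_vec n j $ l) ^ 2))"
      by (rule form) simp
    also have "\<dots> = (\<Sum>l<n. if l = j then cnj (es ! j) else 0)"
      using j by (intro sum.cong) (auto simp: unit_vec_def)
    also have "\<dots> = cnj (es ! j)"
      using j by simp
    finally have "Re (es ! j) = vec_norm (B *\<^sub>v (W *\<^sub>v unit_vec n j)) ^ 2"
      by (metis Re_complex_of_real complex_cnj_cnj complex_cnj_complex_of_real)
    then have "0 \<le> Re (es ! j)" by simp
    moreover have "sigma (Suc j) B = sqrt (Re (es ! j))"
      using j len by (simp add: sigma_def sv)
    ultimately show ?thesis by simp
  qed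
  have "vec_norm (B *\<^sub>v (W *\<^sub>v c)) ^ 2 = (\<Sum>j<n. sigma (Suc j) B ^ 2 * cmod (c $ j) ^ 2)"
    if "c \<in> carrier_vec n" for c
    using arg_cong[OF form[OF that], of Re] sig by simp
  then show thesis
    by (rule that[OF W WW]) (use sig in auto)
qed

section \<open>Variational bounds for singular values\<close>

text \<open>In the coordinates of a right singular basis the squared norm of the image of \<open>x\<close> is
  \<open>\<Sum>j. \<sigma>\<^sub>j\<^sup>2 |c\<^sub>j|\<^sup>2\<close>. If the first \<open>i - 1\<close> coordinates vanish, every weight is at most
  \<open>\<sigma>\<^sub>i\<^sup>2\<close>; if all coordinates after the \<open>j\<close>-th vanish, every weight is at least \<open>\<sigma>\<^sub>j\<^sup>2\<close>.\<close>

lemma right_singular_bounds: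
  fixes B :: "complex mat"
  assumes B: "B \<in> carrier_mat m n"
  obtains W where "W \<in> carrier_mat n n"
    and "\<And>i x. 1 \<le> i \<Longrightarrow> i \<le> n \<Longrightarrow> x \<in> carrier_vec n \<Longrightarrow>
      (\<And>l. l < i - 1 \<Longrightarrow> (mat_adjoint W *\<^sub>v x) $ l = 0) \<Longrightarrow>
      vec_norm (B *\<^sub>v x) \<le> sigma i B * vec_norm x"
    and "\<And>j x. 1 \<le> j \<Longrightarrow> j \<le> n \<Longrightarrow> x \<in> carrier_vec n \<Longrightarrow>
      (\<And>l. j \<le> l \<Longrightarrow> l < n \<Longrightarrow> (mat_adjoint W *\<^sub>v x) $ l = 0) \<Longrightarrow>
      sigma j B * vec_norm x \<le> vec_norm (B *\<^sub>v x)"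
proof -
  obtain W where W: "W \<in> carrier_mat n n" and WW: "mat_adjoint W * W = 1\<^sub>m n"
    and form: "\<And>c. c \<in> carrier_vec n \<Longrightarrow>
      vec_norm (B *\<^sub>v (W *\<^sub>v c)) ^ 2 = (\<Sum>j<n. sigma (Suc j) B ^ 2 * cmod (c $ j) ^ 2)"
    and nonneg: "\<And>j. j < n \<Longrightarrow> 0 \<le> sigma (Suc j) B"
    using right_singular_basis[OF B] by blast
  have W': "mat_adjoint W \<in> carrier_mat n n" using W by simp
  have WW': "W * mat_adjoint W = 1\<^sub>m n"
    using mat_mult_left_right_inverse[OF W' W WW] .
  have coords: "vec_norm (B *\<^sub>v x) ^ 2 =
        (\<Sum>j<n. sigma (Suc j) B ^ 2 * cmod ((mat_adjoint W *\<^sub>v x) $ j) ^ 2)"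
      "vec_norm x ^ 2 = (\<Sum>j<n. cmod ((mat_adjoint W *\<^sub>v x) $ j) ^ 2)"
    if x: "x \<in> carrier_vec n" for x
  proof -
    have c: "mat_adjoint W *\<^sub>v x \<in> carrier_vec n" using W' x by simp
    have x_eq: "W *\<^sub>v (mat_adjoint W *\<^sub>v x) = x"
      using assoc_mult_mat_vec[OF W W' x] WW' x by simp
    show "vec_norm (B *\<^sub>v x) ^ 2 =
        (\<Sum>j<n. sigma (Suc j) B ^ 2 * cmod ((mat_adjoint W *\<^sub>v x) $ j) ^ 2)"
      using form[OF c] unfolding x_eq .
    have "vec_norm x = vec_norm (mat_adjoint W *\<^sub>v x)"
      using vec_norm_isometry[OF W WW c] unfolding x_eq .
    then show "vec_norm x ^ 2 = (\<Sum>j<n. cmod ((mat_adjoint W *\<^sub>v x) $ j) ^ 2)"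
      by (simp only: vec_norm_power2[of "mat_adjoint W *\<^sub>v x"] carrier_vecD[OF c])
  qed
  have dim: "dim_col B = n" using B by simp
  have nonneg': "0 \<le> sigma i B" if "1 \<le> i" "i \<le> n" for i
    using nonneg[of "i - 1"] that by simp
  show thesis
  proof (rule that[OF W])
    fix i x assume i: "1 \<le> i" "i \<le> n" and x: "x \<in> carrier_vec n"
      and zero: "\<And>l. l < i - 1 \<Longrightarrow> (mat_adjoint W *\<^sub>v x) $ l = 0"
    have "vec_norm (B *\<^sub>v x) ^ 2 \<le> sigma i B ^ 2 * vec_norm x ^ 2"
      unfolding coords[OF x] sum_distrib_left
    proof (rule sum_mono)
      fix l assume "l \<in> {..<n}"
      then have l: "l < n" by simp
      show "sigma (Suc l) B ^ 2 * cmod ((mat_adjoint W *\<^sub>v x) $ l) ^ 2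
          \<le> sigma i B ^ 2 * cmod ((mat_adjoint W *\<^sub>v x) $ l) ^ 2"
      proof (cases "l < i - 1")
        case True
        then show ?thesis using zero[of l] by simp
      next
        case False
        then have "sigma (Suc l) B \<le> sigma i B"
          using i l by (intro sigma_antimono) (auto simp: dim)
        then show ?thesis
          using nonneg[OF l] by (intro mult_right_mono power_mono) auto
      qed
    qed
    then have "vec_norm (B *\<^sub>v x) ^ 2 \<le> (sigma i B * vec_norm x) ^ 2"
      by (simp add: power_mult_distrib)
    then show "vec_norm (B *\<^sub>v x) \<le> sigma i B * vec_norm x"
      by (rule power2_le_imp_le) (use nonneg'[OF i] in simp)
  next
    fix i x assume i: "1 \<le> i" "i \<le> n" and x: "x \<in> carrier_vec n"
      and zero: "\<And>l. i \<le> l \<Longrightarrow> l < n \<Longrightarrow> (mat_adjoint W *\<^sub>v x) $ l = 0"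
    have "sigma i B ^ 2 * vec_norm x ^ 2 \<le> vec_norm (B *\<^sub>v x) ^ 2"
      unfolding coords[OF x] sum_distrib_left
    proof (rule sum_mono)
      fix l assume "l \<in> {..<n}"
      then have l: "l < n" by simp
      show "sigma i B ^ 2 * cmod ((mat_adjoint W *\<^sub>v x) $ l) ^ 2
          \<le> sigma (Suc l) B ^ 2 * cmod ((mat_adjoint W *\<^sub>v x) $ l) ^ 2"
      proof (cases "i \<le> l")
        case True
        then show ?thesis using zero[OF _ l] by simp
      next
        case False
        then have "sigma i B \<le> sigma (Suc l) B"
          using i l by (intro sigma_antimono) (auto simp: dim)
        then show ?thesis
          using nonneg'[OF i] by (intro mult_right_mono power_mono) auto
      qed
    qed
    then have "(sigma i B * vec_norm x) ^ 2 \<le> vec_norm (B *\<^sub>v x) ^ 2"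
      by (simp add: power_mult_distrib)
    then show "sigma i B * vec_norm x \<le> vec_norm (B *\<^sub>v x)"
      by (rule power2_le_imp_le) simp
  qed
qed

lemma vec_norm_le_norm2_mat:
  assumes B: "B \<in> carrier_mat m n" and x: "x \<in> carrier_vec n"
  shows "vec_norm (B *\<^sub>v x) \<le> norm2_mat B * vec_norm x"
proof (cases "n = 0")
  case True
  then have "B *\<^sub>v x = 0\<^sub>v m" "x = 0\<^sub>v n"
    using B x by (auto simp: scalar_prod_def)
  then show ?thesis
    by (simp add: vec_norm_def L2_set_def)
next
  case False
  obtain W where "\<And>i x. 1 \<le> i \<Longrightarrow> i \<le> n \<Longrightarrow> x \<in> carrier_vec n \<Longrightarrow>
      (\<And>l. l < i - 1 \<Longrightarrow> (mat_adjoint W *\<^sub>v x) $ l = 0) \<Longrightarrow>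
      vec_norm (B *\<^sub>v x) \<le> sigma i B * vec_norm x"
    using right_singular_bounds[OF B] by metis
  from this[of 1 x] show ?thesis
    using False x by (simp add: norm2_mat_def)
qed

text \<open>The two witness lemmas are the halves of the Courant-Fischer principle in the form in
  which they get used: \<open>X\<close> parametrizes a subspace by \<open>p\<close> unknowns subject to the \<open>q\<close>
  equations of \<open>C\<close>. The subspace has dimension at least \<open>i\<close> here (if \<open>X\<close> is injective
  on the solutions), hence meets the space on which \<open>B\<close> stretches by at most \<open>\<sigma>\<^sub>i\<close>.\<close>

lemma sigma_witness_le:
  fixes B :: "complex mat"
  assumes B: "B \<in> carrier_mat m n" and X: "X \<in> carrier_mat n p" and C: "C \<in> carrier_mat q p"
    and i: "1 \<le> i" "i \<le> n" and "q + i \<le> p"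
  obtains y where "y \<in> carrier_vec p" "y \<noteq> 0\<^sub>v p" "C *\<^sub>v y = 0\<^sub>v q"
    "vec_norm (B *\<^sub>v (X *\<^sub>v y)) \<le> sigma i B * vec_norm (X *\<^sub>v y)"
proof -
  obtain W where W: "W \<in> carrier_mat n n" and bound: "\<And>x. x \<in> carrier_vec n \<Longrightarrow>
      (\<And>l. l < i - 1 \<Longrightarrow> (mat_adjoint W *\<^sub>v x) $ l = 0) \<Longrightarrow>
      vec_norm (B *\<^sub>v x) \<le> sigma i B * vec_norm x"
    using right_singular_bounds[OF B] i by metis
  have W': "mat_adjoint W \<in> carrier_mat n n" using W by simp
  have "mat_adjoint W * X \<in> carrier_mat n p" using W' X by simp
  then obtain y where y: "y \<in> carrier_vec p" "y \<noteq> 0\<^sub>v p" "C *\<^sub>v y = 0\<^sub>v q"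
    and zero: "\<And>l. 0 \<le> l \<Longrightarrow> l < 0 + (i - 1) \<Longrightarrow> (mat_adjoint W * X *\<^sub>v y) $ l = 0"
    using i \<open>q + i \<le> p\<close>
    by (elim common_nontrivial_solution[OF C, of _ n 0 "i - 1"]) auto
  have "vec_norm (B *\<^sub>v (X *\<^sub>v y)) \<le> sigma i B * vec_norm (X *\<^sub>v y)"
    using zero y X by (intro bound) (auto simp: assoc_mult_mat_vec[OF W' X])
  with that y show thesis by blast
qed

text \<open>Here \<open>n - j\<close> further equations confine \<open>X y\<close> to the span of the first \<open>j\<close> right singular
  vectors, on which \<open>B\<close> stretches by at least \<open>\<sigma>\<^sub>j\<close>.\<close>

lemma sigma_witness_ge:
  fixes B :: "complex mat"
  assumes B: "B \<in> carrier_mat m n" and X: "X \<in> carrier_mat n p" and C: "C \<in> carrier_mat q p"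
    and j: "1 \<le> j" "j \<le> n" and "q + n < p + j"
  obtains y where "y \<in> carrier_vec p" "y \<noteq> 0\<^sub>v p" "C *\<^sub>v y = 0\<^sub>v q"
    "sigma j B * vec_norm (X *\<^sub>v y) \<le> vec_norm (B *\<^sub>v (X *\<^sub>v y))"
proof -
  obtain W where W: "W \<in> carrier_mat n n" and bound: "\<And>x. x \<in> carrier_vec n \<Longrightarrow>
      (\<And>l. j \<le> l \<Longrightarrow> l < n \<Longrightarrow> (mat_adjoint W *\<^sub>v x) $ l = 0) \<Longrightarrow>
      sigma j B * vec_norm x \<le> vec_norm (B *\<^sub>v x)"
    using right_singular_bounds[OF B] j by metis
  have W': "mat_adjoint W \<in> carrier_mat n n" using W by simp
  have "mat_adjoint W * X \<in> carrier_mat n p" using W' X by simp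
  then obtain y where y: "y \<in> carrier_vec p" "y \<noteq> 0\<^sub>v p" "C *\<^sub>v y = 0\<^sub>v q"
    and zero: "\<And>l. j \<le> l \<Longrightarrow> l < j + (n - j) \<Longrightarrow> (mat_adjoint W * X *\<^sub>v y) $ l = 0"
    using j \<open>q + n < p + j\<close>
    by (elim common_nontrivial_solution[OF C, of _ n j "n - j"]) auto
  have "sigma j B * vec_norm (X *\<^sub>v y) \<le> vec_norm (B *\<^sub>v (X *\<^sub>v y))"
    using zero y X j by (intro bound) (auto simp: assoc_mult_mat_vec[OF W' X])
  with that y show thesis by blast
qed

section \<open>Rank and positive singular values\<close>

text \<open>A maximal independent set of columns of \<open>A\<close> has as many elements as the rank; \<open>Z\<close>
  is the matrix that selects these columns.\<close>

lemma rank_injective_subspace: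
  fixes A :: "complex mat"
  assumes A: "A \<in> carrier_mat m n"
  obtains Z where "Z \<in> carrier_mat n (vec_space.rank m A)"
    "\<And>y. y \<in> carrier_vec (vec_space.rank m A) \<Longrightarrow> y \<noteq> 0\<^sub>v (vec_space.rank m A) \<Longrightarrow>
      A *\<^sub>v (Z *\<^sub>v y) \<noteq> 0\<^sub>v m"
proof -
  interpret vec_space "TYPE(complex)" m .
  obtain S where S: "maximal S (\<lambda>T. T \<subseteq> set (cols A) \<and> lin_indpt T)"
    using maximal_exists_superset[of "set (cols A)" "\<lambda>T. T \<subseteq> set (cols A) \<and> lin_indpt T" "{}"]
    by (auto simp: lin_dep_def)
  then have sub: "S \<subseteq> set (cols A)" and ind: "lin_indpt S"
    by (auto simp: maximal_def)
  have rank: "rank A = card S"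
    using rank_card_indpt[OF A S] .
  obtain xs where xs: "set xs = S" "distinct xs"
    using finite_distinct_list finite_subset[OF sub] by blast
  have len: "length xs = rank A"
    using xs rank distinct_card by metis
  have carr: "set xs \<subseteq> carrier_vec m"
    using xs sub cols_dim A by blast
  define X where "X = mat_of_cols m xs"
  have X: "X \<in> carrier_mat m (rank A)" by (simp add: X_def flip: len)
  have colsX: "cols X = xs"
    using carr by (simp add: X_def)
  have "\<exists>l<n. xs ! j = col A l" if "j < rank A" for j
  proof -
    have "xs ! j \<in> S" using nth_mem[of j xs] that by (simp only: len xs(1))
    then have "xs ! j \<in> set (cols A)" using sub by (rule subsetD[rotated])
    then obtain l where "l < length (cols A)" "xs ! j = cols A ! l"
      by (metis in_set_conv_nth)
    then show ?thesis using A by (intro exI[of _ l]) auto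
  qed
  then obtain f where f: "\<And>j. j < rank A \<Longrightarrow> f j < n" "\<And>j. j < rank A \<Longrightarrow> xs ! j = col A (f j)"
    by metis
  define Z where "Z = mat n (rank A) (\<lambda>(i, j). unit_vec n (f j) $ i :: complex)"
  have Z: "Z \<in> carrier_mat n (rank A)" by (simp add: Z_def)
  have "A * Z = X"
  proof (rule mat_col_eqI)
    fix j assume "j < dim_col X"
    then have j: "j < rank A" using X by simp
    have "col Z j = unit_vec n (f j)"
      using j by (auto simp: Z_def)
    moreover have "A *\<^sub>v unit_vec n (f j) = col A (f j)"
      using A f(1)[OF j] by (intro eq_vecI) auto
    ultimately have "col (A * Z) j = col A (f j)"
      by (simp only: col_mult2[OF A Z j])
    then show "col (A * Z) j = col X j"
      using f(2)[OF j] colsX j X by (metis carrier_matD(2) cols_nth)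
  qed (use A Z X in auto)
  then have "A *\<^sub>v (Z *\<^sub>v y) \<noteq> 0\<^sub>v m"
    if "y \<in> carrier_vec (rank A)" "y \<noteq> 0\<^sub>v (rank A)" for y
    using lin_depI[OF X that] that ind xs colsX A Z by (metis assoc_mult_mat_vec)
  with that[OF Z] show thesis by blast
qed

text \<open>If \<open>\<sigma>\<^sub>i\<close> vanished for some \<open>i\<close> up to the rank, then a nonzero vector of a subspace on which
  \<open>A\<close> is injective would be mapped to zero.\<close>

lemma sigma_pos:
  fixes A :: "complex mat"
  assumes A: "A \<in> carrier_mat m n" and i: "1 \<le> i" "i \<le> vec_space.rank m A"
  shows "0 < sigma i A"
proof -
  let ?r = "vec_space.rank m A"
  interpret vec_space "TYPE(complex)" m .
  obtain Z where Z: "Z \<in> carrier_mat n ?r"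
    and inj: "\<And>y. y \<in> carrier_vec ?r \<Longrightarrow> y \<noteq> 0\<^sub>v ?r \<Longrightarrow> A *\<^sub>v (Z *\<^sub>v y) \<noteq> 0\<^sub>v m"
    using rank_injective_subspace[OF A] by blast
  have "i \<le> n" using rank_le_nc[OF A] i by simp
  then obtain y where y: "y \<in> carrier_vec ?r" "y \<noteq> 0\<^sub>v ?r"
    and le: "vec_norm (A *\<^sub>v (Z *\<^sub>v y)) \<le> sigma i A * vec_norm (Z *\<^sub>v y)"
    using sigma_witness_le[OF A Z, of "0\<^sub>m 0 ?r" 0 i] i by auto
  have "0 < vec_norm (A *\<^sub>v (Z *\<^sub>v y))"
    using inj[OF y] A Z y(1) by (subst vec_norm_pos_iff[of _ m]) auto
  with le have "0 < sigma i A * vec_norm (Z *\<^sub>v y)" by simp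
  then show ?thesis
    using vec_norm_nonneg[of "Z *\<^sub>v y"] by (simp add: zero_less_mult_iff)
qed

section \<open>Compressions that are congruent to a perturbed identity\<close>

text \<open>With \<open>u = K z\<close> these are bounds for the quadratic form of \<open>1 + K\<close> from below, by the
  norm of the argument and by the norm of the image. For invertible \<open>1 + K\<close> the second one
  says that the Hermitian part of its inverse is at least \<open>1 / (1 + k)\<close>. With
  \<open>a = \<parallel>z\<parallel>\<close>, \<open>b = \<parallel>u\<parallel>\<close> and \<open>\<rho> = Re (u \<bullet>c z)\<close> it amounts to \<open>b\<^sup>2 + (1 - k) \<rho> \<le> k a\<^sup>2\<close>,
  and \<open>k \<le> 1\<close> is what allows \<open>\<rho>\<close> to be replaced by its upper bound \<open>b a\<close>.\<close>

lemma contraction_perturbation: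
  assumes z: "z \<in> carrier_vec r" and u: "u \<in> carrier_vec r"
    and le: "vec_norm u \<le> k * vec_norm z" and k: "k \<le> 1"
  shows "(1 - k) * vec_norm z ^ 2 \<le> Re ((z + u) \<bullet>c z)"
    and "vec_norm (z + u) ^ 2 \<le> (1 + k) * Re ((z + u) \<bullet>c z)"
proof -
  define a b \<rho> where "a = vec_norm z" and "b = vec_norm u" and "\<rho> = Re (u \<bullet>c z)"
  have "\<bar>\<rho>\<bar> \<le> cmod (u \<bullet>c z)"
    unfolding \<rho>_def by (rule abs_Re_le_cmod)
  then have \<rho>: "\<bar>\<rho>\<bar> \<le> b * a"
    using cauchy_schwarz_vec[OF u z] by (simp add: a_def b_def)
  have a: "0 \<le> a" and b: "0 \<le> b" "b \<le> k * a"
    using le by (simp_all add: a_def b_def)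
  have inner: "Re ((z + u) \<bullet>c z) = a ^ 2 + \<rho>"
    using z u by (simp add: add_scalar_prod_distrib[of _ r] cscalar_prod_self a_def \<rho>_def)
  have comm: "z \<bullet>c u = cnj (u \<bullet>c z)"
    using z u by (intro cscalar_prod_commute) simp
  have "complex_of_real (vec_norm (z + u) ^ 2) = z \<bullet>c z + u \<bullet>c z + (z \<bullet>c u + u \<bullet>c u)"
    unfolding cscalar_prod_self[symmetric] using z u
    by (simp add: conjugate_add_vec[of _ r] add_scalar_prod_distrib[of _ r]
        scalar_prod_add_distrib[of _ r])
  then have "Re (complex_of_real (vec_norm (z + u) ^ 2)) = Re (z \<bullet>c z + u \<bullet>c z + (z \<bullet>c u + u \<bullet>c u))"
    by (rule arg_cong)
  then have sum: "vec_norm (z + u) ^ 2 = a ^ 2 + 2 * \<rho> + b ^ 2"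
    unfolding comm cscalar_prod_self by (simp add: a_def b_def \<rho>_def)
  have ba: "b * a \<le> k * a ^ 2"
    using mult_right_mono[OF b(2) a] by (simp add: power2_eq_square)
  show "(1 - k) * vec_norm z ^ 2 \<le> Re ((z + u) \<bullet>c z)"
    using \<rho> ba unfolding inner a_def[symmetric] by (simp add: algebra_simps)
  have "b * b \<le> k * a * b"
    using mult_right_mono[OF b(2) b(1)] .
  moreover have "(1 - k) * \<rho> \<le> (1 - k) * (b * a)"
    using \<rho> k by (intro mult_left_mono) auto
  ultimately have "b ^ 2 + (1 - k) * \<rho> \<le> k * a ^ 2"
    using ba by (simp add: power2_eq_square algebra_simps)
  then show "vec_norm (z + u) ^ 2 \<le> (1 + k) * Re ((z + u) \<bullet>c z)"
    unfolding sum inner by (simp add: algebra_simps)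
qed

text \<open>The singular value decomposition enters the estimates only through the data collected
  here: the compression of \<open>B\<close> to two \<open>r\<close>-dimensional subspaces is \<open>S\<^sup>1\<^sup>/\<^sup>2 (1 + K) S\<^sup>1\<^sup>/\<^sup>2\<close> with
  a positive nonincreasing diagonal matrix \<open>S\<close> and a contraction \<open>K\<close>.\<close>

locale accretive_compression =
  fixes m n r :: nat and B U V K :: "complex mat" and s :: "nat \<Rightarrow> real" and k :: real
  assumes dims: "r \<le> m" "r \<le> n"
    and B: "B \<in> carrier_mat m n"
    and U: "U \<in> carrier_mat m r" "mat_adjoint U * U = 1\<^sub>m r"
    and V: "V \<in> carrier_mat n r" "mat_adjoint V * V = 1\<^sub>m r"
    and K: "K \<in> carrier_mat r r"
    and K_le: "\<And>z. z \<in> carrier_vec r \<Longrightarrow> vec_norm (K *\<^sub>v z) \<le> k * vec_norm z"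
    and k_le_1: "k \<le> 1"
    and s_pos: "\<And>j. j < r \<Longrightarrow> 0 < s j"
    and s_antimono: "\<And>i j. i \<le> j \<Longrightarrow> j < r \<Longrightarrow> s j \<le> s i"
    and compression: "mat_adjoint U * B * V =
      mat_diag r (\<lambda>j. complex_of_real (sqrt (s j))) * (1\<^sub>m r + K) *
      mat_diag r (\<lambda>j. complex_of_real (sqrt (s j)))"
begin

definition sqrt_scale :: "complex vec \<Rightarrow> complex vec" where
  "sqrt_scale y = vec r (\<lambda>j. complex_of_real (sqrt (s j)) * y $ j)"

lemma sqrt_scale_carrier [simp]: "sqrt_scale y \<in> carrier_vec r"
  by (simp add: sqrt_scale_def)

lemma k_nonneg:
  assumes "1 \<le> r"
  shows "0 \<le> k"
proof -
  have "0 < vec_norm (unit_vec r 0)"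
    using assms by (subst vec_norm_pos_iff[of _ r]) auto
  moreover have "0 \<le> k * vec_norm (unit_vec r 0)"
    using K_le[of "unit_vec r 0"] by (rule order_trans[OF vec_norm_nonneg]) simp
  ultimately show ?thesis by (simp add: zero_le_mult_iff)
qed

lemma sqrt_scale_adjoint:
  assumes "y \<in> carrier_vec r" "z \<in> carrier_vec r"
  shows "sqrt_scale y \<bullet>c z = y \<bullet>c sqrt_scale z"
  using assms by (auto simp: sqrt_scale_def scalar_prod_def mult_ac intro!: sum.cong)

lemma vec_norm_sqrt_scale: "vec_norm (sqrt_scale y) ^ 2 = (\<Sum>j<r. s j * cmod (y $ j) ^ 2)"
  using s_pos by (auto simp: vec_norm_power2 sqrt_scale_def norm_mult power_mult_distrib less_imp_le
      intro!: sum.cong)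

lemma compression_vec:
  assumes w: "w \<in> carrier_vec r"
  shows "mat_adjoint U *\<^sub>v (B *\<^sub>v (V *\<^sub>v w)) = sqrt_scale (sqrt_scale w + K *\<^sub>v sqrt_scale w)"
proof -
  define D where "D = mat_diag r (\<lambda>j. complex_of_real (sqrt (s j)))"
  have D: "D \<in> carrier_mat r r" by (simp add: D_def)
  have Dv: "D *\<^sub>v y = sqrt_scale y" if "y \<in> carrier_vec r" for y
  proof (rule eq_vecI)
    fix i assume "i < dim_vec (sqrt_scale y)"
    then have i: "i < r" by (simp add: sqrt_scale_def)
    have "(D *\<^sub>v y) $ i = (\<Sum>j<r. D $$ (i, j) * y $ j)"
      using i D that by (auto simp: scalar_prod_def lessThan_atLeast0 intro!: sum.cong)
    also have "\<dots> = (\<Sum>j<r. if j = i then complex_of_real (sqrt (s i)) * y $ i else 0)"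
      using i by (intro sum.cong) (auto simp: D_def mat_diag_def)
    finally show "(D *\<^sub>v y) $ i = sqrt_scale y $ i"
      using i by (simp add: sqrt_scale_def)
  qed (use D in \<open>simp add: sqrt_scale_def\<close>)
  have U': "mat_adjoint U \<in> carrier_mat r m" using U by simp
  have UB: "mat_adjoint U * B \<in> carrier_mat r n" using U' B by simp
  have IK: "1\<^sub>m r + K \<in> carrier_mat r r" using K by simp
  have "mat_adjoint U *\<^sub>v (B *\<^sub>v (V *\<^sub>v w)) = (mat_adjoint U * B * V) *\<^sub>v w"
    using U' UB B V w by (simp add: assoc_mult_mat_vec[of _ r n _ r] assoc_mult_mat_vec[of _ r m _ n]
        del: assoc_mult_mat)
  also have "\<dots> = D *\<^sub>v ((1\<^sub>m r + K) *\<^sub>v (D *\<^sub>v w))"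
    unfolding compression D_def[symmetric]
    using D IK w by (simp add: assoc_mult_mat_vec[of _ r r _ r] mult_carrier_mat[of _ r r])
  also have "\<dots> = sqrt_scale (sqrt_scale w + K *\<^sub>v sqrt_scale w)"
    using K IK w by (simp add: Dv add_mult_distrib_mat_vec[of _ r r])
  finally show ?thesis .
qed

text \<open>Moving one factor \<open>S\<^sup>1\<^sup>/\<^sup>2\<close> to the other side of the inner product turns the quadratic form
  of the compression at \<open>w\<close> into that of \<open>1 + K\<close> at \<open>z = S\<^sup>1\<^sup>/\<^sup>2 w\<close>.\<close>

lemma sqrt_scale_perturbation:
  assumes w: "w \<in> carrier_vec r"
  shows "(1 - k) * vec_norm (sqrt_scale w) ^ 2 \<le> Re ((mat_adjoint U *\<^sub>v (B *\<^sub>v (V *\<^sub>v w))) \<bullet>c w)"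
    and "vec_norm (sqrt_scale w + K *\<^sub>v sqrt_scale w) ^ 2
      \<le> (1 + k) * Re ((mat_adjoint U *\<^sub>v (B *\<^sub>v (V *\<^sub>v w))) \<bullet>c w)"
proof -
  have Kz: "K *\<^sub>v sqrt_scale w \<in> carrier_vec r" using K by simp
  have "sqrt_scale (sqrt_scale w + K *\<^sub>v sqrt_scale w) \<bullet>c w = (sqrt_scale w + K *\<^sub>v sqrt_scale w) \<bullet>c sqrt_scale w"
    using Kz w by (intro sqrt_scale_adjoint) auto
  then show "(1 - k) * vec_norm (sqrt_scale w) ^ 2 \<le> Re ((mat_adjoint U *\<^sub>v (B *\<^sub>v (V *\<^sub>v w))) \<bullet>c w)"
    and "vec_norm (sqrt_scale w + K *\<^sub>v sqrt_scale w) ^ 2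
      \<le> (1 + k) * Re ((mat_adjoint U *\<^sub>v (B *\<^sub>v (V *\<^sub>v w))) \<bullet>c w)"
    unfolding compression_vec[OF w]
    using contraction_perturbation[OF sqrt_scale_carrier Kz K_le[OF sqrt_scale_carrier] k_le_1] by simp_all
qed

text \<open>On the span of the first \<open>i\<close> coordinate vectors the quadratic form of the compression is
  at least \<open>(1 - k) s (i - 1) \<parallel>y\<parallel>\<^sup>2\<close>, and by Cauchy-Schwarz it is at most \<open>\<parallel>B V y\<parallel> \<parallel>y\<parallel>\<close>.\<close>

lemma sigma_lower:
  assumes i: "1 \<le> i" "i \<le> r"
  shows "(1 - k) * s (i - 1) \<le> sigma i B"
proof -
  \<comment> \<open>The equations \<open>y $ l = 0\<close> for \<open>i \<le> l < r\<close>.\<close>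
  define C where "C = mat (r - i) r (\<lambda>(a, b). if b = i + a then 1 else 0 :: complex)"
  have C: "C \<in> carrier_mat (r - i) r" by (simp add: C_def)
  have "i \<le> n" "r - i + i \<le> r" using i dims by auto
  then obtain y where y: "y \<in> carrier_vec r" "y \<noteq> 0\<^sub>v r" and Cy: "C *\<^sub>v y = 0\<^sub>v (r - i)"
    and le: "vec_norm (B *\<^sub>v (V *\<^sub>v y)) \<le> sigma i B * vec_norm (V *\<^sub>v y)"
    using sigma_witness_le[OF B V(1) C i(1)] by blast
  have y0: "y $ l = 0" if "i \<le> l" "l < r" for l
  proof -
    have "row C (l - i) = unit_vec r l"
      using that by (auto simp: C_def)
    then have "(C *\<^sub>v y) $ (l - i) = y $ l"
      using that C y(1) by simp
    then show ?thesis using Cy that by simp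
  qed
  have BVy: "B *\<^sub>v (V *\<^sub>v y) \<in> carrier_vec m" and Uy: "U *\<^sub>v y \<in> carrier_vec m"
    using B U by simp_all
  have "s (i - 1) * vec_norm y ^ 2 \<le> vec_norm (sqrt_scale y) ^ 2"
    unfolding vec_norm_sqrt_scale vec_norm_power2[of y] carrier_vecD[OF y(1)] sum_distrib_left
  proof (rule sum_mono)
    fix l assume "l \<in> {..<r}"
    then show "s (i - 1) * cmod (y $ l) ^ 2 \<le> s l * cmod (y $ l) ^ 2"
      using y0[of l] s_antimono[of l "i - 1"] i
      by (cases "i \<le> l") (auto intro: mult_right_mono)
  qed
  then have "(1 - k) * (s (i - 1) * vec_norm y ^ 2) \<le> (1 - k) * vec_norm (sqrt_scale y) ^ 2"
    using k_le_1 by (intro mult_left_mono) auto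
  also have "\<dots> \<le> Re ((mat_adjoint U *\<^sub>v (B *\<^sub>v (V *\<^sub>v y))) \<bullet>c y)"
    by (rule sqrt_scale_perturbation(1)[OF y(1)])
  also have "(mat_adjoint U *\<^sub>v (B *\<^sub>v (V *\<^sub>v y))) \<bullet>c y = (B *\<^sub>v (V *\<^sub>v y)) \<bullet>c (U *\<^sub>v y)"
    using cscalar_prod_mult_mat_vec[of "mat_adjoint U" r m "B *\<^sub>v (V *\<^sub>v y)" y] U BVy y by simp
  also have "Re \<dots> \<le> vec_norm (B *\<^sub>v (V *\<^sub>v y)) * vec_norm (U *\<^sub>v y)"
    using complex_Re_le_cmod cauchy_schwarz_vec[OF BVy Uy] by (rule order_trans)
  also have "\<dots> \<le> sigma i B * vec_norm y * vec_norm y"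
    using le by (simp add: vec_norm_isometry[OF U y(1)] vec_norm_isometry[OF V y(1)] mult_right_mono)
  finally have "(1 - k) * s (i - 1) * vec_norm y ^ 2 \<le> sigma i B * vec_norm y ^ 2"
    by (simp add: power2_eq_square mult_ac)
  moreover have "0 < vec_norm y ^ 2"
    using y vec_norm_pos_iff[OF y(1)] by simp
  ultimately show ?thesis
    by (simp only: mult_le_cancel_right_pos)
qed

text \<open>Write \<open>v = S\<^sup>1\<^sup>/\<^sup>2 g\<close> with \<open>g = (1 + K) S\<^sup>1\<^sup>/\<^sup>2 w\<close>. Since \<open>v\<close> has no component along the large
  entries of \<open>S\<close>, we have \<open>\<parallel>v\<parallel>\<^sup>2 \<le> s (i - 1) \<parallel>g\<parallel>\<^sup>2\<close>; and \<open>\<parallel>g\<parallel>\<^sup>2 \<le> (1 + k) Re (v \<bullet>c w)\<close>, which is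
  at most \<open>(1 + k) \<parallel>v\<parallel> \<parallel>w\<parallel>\<close>. The condition is imposed on the image \<open>v\<close> and not on \<open>w\<close>
  because the left factor \<open>S\<^sup>1\<^sup>/\<^sup>2\<close> would amplify components of \<open>g\<close> along its large entries,
  and \<open>K\<close> may produce such components even if \<open>w\<close> has none.\<close>

lemma preimage_bound:
  assumes i: "1 \<le> i" "i \<le> r" and w: "w \<in> carrier_vec r" and v: "v \<in> carrier_vec r"
    and eq: "B *\<^sub>v (V *\<^sub>v w) = U *\<^sub>v v" and v0: "\<And>l. l < i - 1 \<Longrightarrow> v $ l = 0"
  shows "vec_norm v \<le> (1 + k) * s (i - 1) * vec_norm w"
proof (cases "vec_norm v = 0")
  case True
  moreover have "0 \<le> (1 + k) * s (i - 1) * vec_norm w"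
    using s_pos[of "i - 1"] k_nonneg i by (intro mult_nonneg_nonneg) (auto intro: less_imp_le)
  ultimately show ?thesis by simp
next
  case False
  define g where "g = sqrt_scale w + K *\<^sub>v sqrt_scale w"
  have "mat_adjoint U *\<^sub>v (U *\<^sub>v v) = v"
    using U v by (simp flip: assoc_mult_mat_vec[of _ r m _ r])
  then have UBVw: "mat_adjoint U *\<^sub>v (B *\<^sub>v (V *\<^sub>v w)) = v" by (simp add: eq)
  then have v_eq: "v = sqrt_scale g" using compression_vec[OF w] by (simp add: g_def)
  have g: "g \<in> carrier_vec r" using K by (simp add: g_def)
  have "vec_norm v ^ 2 = (\<Sum>l<r. s l * cmod (g $ l) ^ 2)"
    unfolding v_eq by (rule vec_norm_sqrt_scale)
  also have "\<dots> \<le> (\<Sum>l<r. s (i - 1) * cmod (g $ l) ^ 2)"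
  proof (rule sum_mono)
    fix l assume "l \<in> {..<r}"
    then have l: "l < r" by simp
    show "s l * cmod (g $ l) ^ 2 \<le> s (i - 1) * cmod (g $ l) ^ 2"
    proof (cases "l < i - 1")
      case True
      then have "sqrt_scale g $ l = 0" using v0 v_eq by simp
      then have "g $ l = 0" using l s_pos[OF l] by (simp add: sqrt_scale_def)
      then show ?thesis by simp
    next
      case False
      then show ?thesis using s_antimono[of "i - 1" l] l by (intro mult_right_mono) auto
    qed
  qed
  also have "\<dots> = s (i - 1) * vec_norm g ^ 2"
    by (simp only: vec_norm_power2 carrier_vecD[OF g] sum_distrib_left)
  finally have 1: "vec_norm v ^ 2 \<le> s (i - 1) * vec_norm g ^ 2" .
  have 2: "vec_norm g ^ 2 \<le> (1 + k) * Re (v \<bullet>c w)"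
    using sqrt_scale_perturbation(2)[OF w] unfolding UBVw g_def .
  have "0 \<le> 1 + k" using k_nonneg i by simp
  then have "(1 + k) * Re (v \<bullet>c w) \<le> (1 + k) * (vec_norm v * vec_norm w)"
    using order_trans[OF complex_Re_le_cmod cauchy_schwarz_vec[OF v w]] by (rule mult_left_mono[rotated])
  with 2 have "vec_norm g ^ 2 \<le> (1 + k) * (vec_norm v * vec_norm w)" by simp
  then have "s (i - 1) * vec_norm g ^ 2 \<le> s (i - 1) * ((1 + k) * (vec_norm v * vec_norm w))"
    using s_pos[of "i - 1"] i by (intro mult_left_mono) (auto intro: less_imp_le)
  with 1 have "vec_norm v * vec_norm v \<le> (1 + k) * s (i - 1) * vec_norm w * vec_norm v"
    by (simp add: power2_eq_square mult_ac)
  then show ?thesis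
    using False vec_norm_nonneg[of v] by (simp add: mult_le_cancel_right)
qed

text \<open>The unknown is the pair \<open>(w, v)\<close> stored as one vector of length \<open>2 r\<close>, subject to the \<open>m\<close>
  equations \<open>B V w = U v\<close> and the \<open>i - 1\<close> equations that make \<open>v\<close> start with zeros. Keeping
  \<open>v\<close> as an unknown says that \<open>B V w\<close> lies in the range of \<open>U\<close> without completing \<open>U\<close> to a
  unitary matrix. Together with the \<open>n - (m + n - 2 r + i)\<close> conditions of the witness lemma
  these are \<open>2 r - 1\<close> equations, one less than the unknowns; this is where the index shift
  in the statement comes from.\<close>

lemma sigma_upper:
  assumes i: "1 \<le> i" "i \<le> 2 * r - m"
  shows "sigma (m + n - 2 * r + i) B \<le> (1 + k) * s (i - 1)"
proof -
  have ir: "i \<le> r" using i dims by simp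
  define P1 where "P1 = mat r (2 * r) (\<lambda>(a, b). if b = a then 1 else 0 :: complex)"
  define P2 where "P2 = mat r (2 * r) (\<lambda>(a, b). if b = r + a then 1 else 0 :: complex)"
  have P: "P1 \<in> carrier_mat r (2 * r)" "P2 \<in> carrier_mat r (2 * r)"
    by (simp_all add: P1_def P2_def)
  have P1y: "P1 *\<^sub>v y = vec r (\<lambda>a. y $ a)" and P2y: "P2 *\<^sub>v y = vec r (\<lambda>a. y $ (r + a))"
    if "y \<in> carrier_vec (2 * r)" for y
  proof -
    have "row P1 a = unit_vec (2 * r) a" "row P2 a = unit_vec (2 * r) (r + a)" if "a < r" for a
      using that by (auto simp: P1_def P2_def)
    then show "P1 *\<^sub>v y = vec r (\<lambda>a. y $ a)" "P2 *\<^sub>v y = vec r (\<lambda>a. y $ (r + a))"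
      using P \<open>y \<in> carrier_vec (2 * r)\<close> by (auto intro!: eq_vecI)
  qed
  define M where "M = B * V * P1 - U * P2"
  have BVP: "B * V * P1 \<in> carrier_mat m (2 * r)" and UP: "U * P2 \<in> carrier_mat m (2 * r)"
    and VP: "V * P1 \<in> carrier_mat n (2 * r)" and BV: "B * V \<in> carrier_mat m r"
    using B V U P by auto
  have M: "M \<in> carrier_mat m (2 * r)" unfolding M_def using UP by (rule minus_carrier_mat)
  define C where "C = mat\<^sub>r (m + (i - 1)) (2 * r)
    (\<lambda>l. if l < m then row M l else row P2 (l - m))"
  have C: "C \<in> carrier_mat (m + (i - 1)) (2 * r)" by (simp add: C_def)
  have "1 \<le> m + n - 2 * r + i" "m + n - 2 * r + i \<le> n"
    "m + (i - 1) + n < 2 * r + (m + n - 2 * r + i)"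
    using i dims by auto
  then obtain y where y: "y \<in> carrier_vec (2 * r)" "y \<noteq> 0\<^sub>v (2 * r)"
    and Cy: "C *\<^sub>v y = 0\<^sub>v (m + (i - 1))"
    and ge: "sigma (m + n - 2 * r + i) B * vec_norm (V * P1 *\<^sub>v y) \<le> vec_norm (B *\<^sub>v (V * P1 *\<^sub>v y))"
    using sigma_witness_ge[OF B VP C] by blast
  define w where "w = P1 *\<^sub>v y"
  define v where "v = P2 *\<^sub>v y"
  have w: "w \<in> carrier_vec r" and v: "v \<in> carrier_vec r"
    using P by (simp_all add: w_def v_def)
  have rows: "row C l \<bullet> y = 0" if "l < m + (i - 1)" for l
    using arg_cong[OF Cy, of "\<lambda>v. v $ l"] that C by simp
  have My: "M *\<^sub>v y = B *\<^sub>v (V *\<^sub>v w) - U *\<^sub>v v"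
  proof -
    have "M *\<^sub>v y = B * V * P1 *\<^sub>v y - U * P2 *\<^sub>v y"
      unfolding M_def by (rule minus_mult_distrib_mat_vec[OF BVP UP y(1)])
    also have "B * V * P1 *\<^sub>v y = B *\<^sub>v (V *\<^sub>v w)"
      unfolding assoc_mult_mat_vec[OF BV P(1) y(1)] w_def[symmetric] by (rule assoc_mult_mat_vec[OF B V(1) w])
    also have "U * P2 *\<^sub>v y = U *\<^sub>v v"
      unfolding v_def by (rule assoc_mult_mat_vec[OF U(1) P(2) y(1)])
    finally show ?thesis .
  qed
  have eq: "B *\<^sub>v (V *\<^sub>v w) = U *\<^sub>v v"
  proof (rule eq_vecI)
    fix l assume "l < dim_vec (U *\<^sub>v v)"
    then have l: "l < m" using U by simp
    have "row C l = row M l"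
      unfolding C_def using l M by (subst row_mat_of_row_fun) auto
    then have "(M *\<^sub>v y) $ l = 0" using rows[of l] l M by simp
    then show "(B *\<^sub>v (V *\<^sub>v w)) $ l = (U *\<^sub>v v) $ l"
      unfolding My using l U B by simp
  qed (use U B in simp)
  have v0: "v $ l = 0" if l: "l < i - 1" for l
  proof -
    have "row C (m + l) = row P2 l"
      unfolding C_def using l P ir by (subst row_mat_of_row_fun) auto
    then show ?thesis using rows[of "m + l"] l ir P by (simp add: v_def)
  qed
  \<comment> \<open>The second half of the pair is determined by the first, as \<open>U\<close> is injective.\<close>
  have "w \<noteq> 0\<^sub>v r"
  proof
    assume w0: "w = 0\<^sub>v r"
    have "vec_norm v = vec_norm (B *\<^sub>v (V *\<^sub>v w))"
      by (simp add: eq vec_norm_isometry[OF U v])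
    also have "B *\<^sub>v (V *\<^sub>v w) = 0\<^sub>v m"
      unfolding w0 using B V by (auto simp: scalar_prod_def intro!: eq_vecI)
    also have "vec_norm (0\<^sub>v m) = 0" by (simp add: vec_norm_def L2_set_def)
    finally have v0: "v = 0\<^sub>v r" using vec_norm_pos_iff[OF v] by simp
    have "y $ a = 0" if "a < 2 * r" for a
    proof (cases "a < r")
      case True
      then show ?thesis using arg_cong[OF w0, of "\<lambda>x. x $ a"] P1y[OF y(1)] by (simp add: w_def)
    next
      case False
      then have "r + (a - r) = a" by simp
      then show ?thesis
        using arg_cong[OF v0, of "\<lambda>x. x $ (a - r)"] P2y[OF y(1)] that False
        by (simp add: v_def del: le_add_diff_inverse)
    qed
    then have "y = 0\<^sub>v (2 * r)" using y(1) by (auto intro!: eq_vecI)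
    with y(2) show False by simp
  qed
  then have pos: "0 < vec_norm w" using vec_norm_pos_iff[OF w] by simp
  have "V * P1 *\<^sub>v y = V *\<^sub>v w"
    unfolding w_def using V P y by (simp add: assoc_mult_mat_vec[of _ n r _ "2 * r"])
  with ge have "sigma (m + n - 2 * r + i) B * vec_norm w \<le> vec_norm v"
    by (simp add: eq vec_norm_isometry[OF U v] vec_norm_isometry[OF V w])
  also have "\<dots> \<le> (1 + k) * s (i - 1) * vec_norm w"
    by (rule preimage_bound[OF i(1) ir w v eq v0])
  finally show ?thesis using pos by (simp only: mult_le_cancel_right_pos)
qed

end

section \<open>Compressing a singular value decomposition\<close>

text \<open>Associativity with side conditions on dimensions only, which rewriting discharges
  without having to guess the shapes of the factors.\<close>

lemma mult_mat_assoc: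
  fixes A B C :: "complex mat"
  assumes "dim_col A = dim_row B" "dim_col B = dim_row C"
  shows "A * B * C = A * (B * C)"
  by (rule assoc_mult_mat) (use assms in auto)

lemma first_cols_carrier:
  assumes "M \<in> carrier_mat m n" "r \<le> n"
  shows "first_cols r M \<in> carrier_mat m r"
  using assms by (auto simp: first_cols_def)

lemma first_cols_index:
  assumes "M \<in> carrier_mat m n" "r \<le> n" "i < m" "j < r"
  shows "first_cols r M $$ (i, j) = M $$ (i, j)"
  using assms by (simp add: first_cols_def mat_of_cols_index)

text \<open>Multiplication by the first columns of the identity turns the truncation of a
  decomposition into plain matrix algebra.\<close>

lemma first_cols_mult:
  fixes M :: "complex mat"
  assumes M: "M \<in> carrier_mat m n" and r: "r \<le> n"
  shows "first_cols r M = M * first_cols r (1\<^sub>m n)"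
proof -
  have J: "first_cols r (1\<^sub>m n :: complex mat) \<in> carrier_mat n r"
    by (rule first_cols_carrier[OF _ r]) simp
  show ?thesis
  proof (rule eq_matI)
    fix i j
    assume "i < dim_row (M * first_cols r (1\<^sub>m n))" "j < dim_col (M * first_cols r (1\<^sub>m n :: complex mat))"
    then have ij: "i < m" "j < r" using M J by auto
    have "col (first_cols r (1\<^sub>m n :: complex mat)) j = unit_vec n j"
      using ij J r by (intro eq_vecI) (auto simp: first_cols_index[of _ n n])
    then show "first_cols r M $$ (i, j) = (M * first_cols r (1\<^sub>m n)) $$ (i, j)"
      using ij M J r by (simp add: first_cols_index[OF M r])
  qed (use first_cols_carrier[OF M r] M J in auto)
qed

lemma first_cols_compression:
  fixes L :: "nat \<Rightarrow> complex"
  assumes "r \<le> n"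
  shows "mat_adjoint (first_cols r (1\<^sub>m n)) * (mat_diag n L * first_cols r (1\<^sub>m n)) = mat_diag r L"
proof -
  define J where "J = first_cols r (1\<^sub>m n :: complex mat)"
  have J: "J \<in> carrier_mat n r"
    unfolding J_def by (rule first_cols_carrier[OF _ assms]) simp
  have Jij: "J $$ (i, j) = (if i = j then 1 else 0)" if "i < n" "j < r" for i j
    using that assms by (simp add: J_def first_cols_index[of _ n n])
  have LJ: "mat_diag n L * J = mat n r (\<lambda>(i, j). L i * J $$ (i, j))"
    using J by (rule mat_diag_mult_left)
  have "mat_adjoint J * (mat_diag n L * J) = mat_diag r L"
  proof (rule eq_matI)
    fix i j assume "i < dim_row (mat_diag r L)" "j < dim_col (mat_diag r L)"
    then have ij: "i < r" "j < r" by (auto simp: mat_diag_def)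
    have "(mat_adjoint J * (mat_diag n L * J)) $$ (i, j) =
        (\<Sum>l<n. cnj (J $$ (l, i)) * (L l * J $$ (l, j)))"
      unfolding LJ using ij J by (auto simp: scalar_prod_def lessThan_atLeast0 intro!: sum.cong)
    also have "\<dots> = (\<Sum>l<n. if l = i then (if i = j then L i else 0) else 0)"
      using ij by (intro sum.cong) (auto simp: Jij)
    finally show "(mat_adjoint J * (mat_diag n L * J)) $$ (i, j) = mat_diag r L $$ (i, j)"
      using ij assms by (simp add: mat_diag_def)
  qed (use J in \<open>auto simp: mat_diag_def\<close>)
  then show ?thesis by (simp add: J_def)
qed

lemma thin_svd_first_cols:
  assumes A: "A \<in> carrier_mat m n" and svd: "thin_svd A U V" and r: "r \<le> n"
  shows "mat_adjoint (first_cols r U) * first_cols r U = 1\<^sub>m r"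
    and "mat_adjoint (first_cols r V) * first_cols r V = 1\<^sub>m r"
    and "mat_adjoint (first_cols r U) * A * first_cols r V = Sigma_mat r A"
proof -
  define J where "J = first_cols r (1\<^sub>m n :: complex mat)"
  have J: "J \<in> carrier_mat n r"
    unfolding J_def by (rule first_cols_carrier[OF _ r]) simp
  have U: "U \<in> carrier_mat m n" and UU: "mat_adjoint U * U = 1\<^sub>m n"
    and V: "V \<in> carrier_mat n n" and VV: "mat_adjoint V * V = 1\<^sub>m n"
    and A_eq: "A = U * Sigma_mat n A * mat_adjoint V"
    using svd A by (auto simp: thin_svd_def Let_def)
  define S where "S = Sigma_mat n A"
  have S: "S \<in> carrier_mat n n" by (simp add: S_def Sigma_mat_def)
  have UJ: "first_cols r U = U * J" and VJ: "first_cols r V = V * J"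
    unfolding J_def using first_cols_mult[OF U r] first_cols_mult[OF V r] by auto
  have JJ: "mat_adjoint J * J = 1\<^sub>m r"
    using first_cols_compression[OF r, of "\<lambda>_. 1"] J by (simp flip: J_def)
  have cancel: "mat_adjoint X * (X * Y) = Y"
    if "X \<in> carrier_mat p n" "Y \<in> carrier_mat n q" "mat_adjoint X * X = 1\<^sub>m n" for X Y :: "complex mat" and p q
  proof -
    have "mat_adjoint X * (X * Y) = mat_adjoint X * X * Y"
      by (rule mult_mat_assoc[symmetric]) (use that in auto)
    also have "\<dots> = Y" unfolding that(3) using that(2) by (rule left_mult_one_mat)
    finally show ?thesis .
  qed
  have adj: "mat_adjoint (X * J) = mat_adjoint J * mat_adjoint X" if "X \<in> carrier_mat p n" for X :: "complex mat" and p
    using mat_adjoint_mult[OF that J] .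
  show "mat_adjoint (first_cols r U) * first_cols r U = 1\<^sub>m r"
    using U J by (simp add: UJ adj[OF U] mult_mat_assoc cancel[OF U J UU] JJ)
  show "mat_adjoint (first_cols r V) * first_cols r V = 1\<^sub>m r"
    using V J by (simp add: VJ adj[OF V] mult_mat_assoc cancel[OF V J VV] JJ)
  have SJ: "S * J \<in> carrier_mat n r" using S J by simp
  have "mat_adjoint (U * J) * (U * S * mat_adjoint V) * (V * J) = mat_adjoint J * (S * J)"
    using U V S J
    by (simp add: adj[OF U] mult_mat_assoc cancel[OF U SJ UU] cancel[OF V J VV])
  also have "\<dots> = Sigma_mat r A"
    unfolding S_def Sigma_mat_def J_def by (rule first_cols_compression[OF r])
  finally show "mat_adjoint (first_cols r U) * A * first_cols r V = Sigma_mat r A"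
    using A_eq by (simp add: UJ VJ flip: S_def)
qed

lemma sqrt_mult_powr_minus_half:
  assumes "0 < (x :: real)"
  shows "sqrt x * x powr (- 1 / 2) = 1"
proof -
  have "sqrt x * x powr (- 1 / 2) = x powr (1 / 2) * x powr (- 1 / 2)"
    using assms by (simp add: powr_half_sqrt)
  also have "\<dots> = x powr 0"
    by (simp flip: powr_add)
  finally show ?thesis using assms by simp
qed

theorem theorem4p1:
  fixes m n r :: nat and A E U V :: "complex mat" and k :: real
  assumes "n \<le> m"
    and "A \<in> carrier_mat m n"
    and "vec_space.rank m A = r"
    and "thin_svd A U V"
    and "E \<in> carrier_mat m n"
    and "k = norm2_mat (S_plus r A U V * E * S_plus r A U V)"
    and "k \<le> 1"
  shows "(\<forall>i \<in> {1..2 * r - m}. sigma (m + n - 2 * r + i) (A + E) \<le> sigma i A + k * sigma i A) \<and>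
         (\<forall>i \<in> {1..r}. sigma i (A + E) \<ge> sigma i A - k * sigma i A)"
proof -
  interpret vec_space "TYPE(complex)" m .
  note A = \<open>A \<in> carrier_mat m n\<close> and E = \<open>E \<in> carrier_mat m n\<close> and svd = \<open>thin_svd A U V\<close>
  have r: "r \<le> n" using rank_le_nc[OF A] assms(3) by simp
  define Ur where "Ur = first_cols r U"
  define Vr where "Vr = first_cols r V"
  have "U \<in> carrier_mat m n" "V \<in> carrier_mat n n"
    using svd A by (auto simp: thin_svd_def Let_def)
  then have Ur: "Ur \<in> carrier_mat m r" and Vr: "Vr \<in> carrier_mat n r"
    unfolding Ur_def Vr_def by (auto intro: first_cols_carrier[OF _ r])
  note UU = thin_svd_first_cols(1)[OF A svd r, folded Ur_def]
    and VV = thin_svd_first_cols(2)[OF A svd r, folded Vr_def]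
    and UAV = thin_svd_first_cols(3)[OF A svd r, folded Ur_def Vr_def]
  have dimA: "dim_col A = n" using A by simp
  have pos: "0 < sigma (Suc j) A" if "j < r" for j
    using sigma_pos[OF A, of "Suc j"] that assms(3) by simp
  define D where "D = mat_diag r (\<lambda>j. complex_of_real (sqrt (sigma (Suc j) A)))"
  define D' where "D' = Sigma_inv_sqrt r A"
  define K where "K = D' * (mat_adjoint Ur * E * Vr) * D'"
  have D: "D \<in> carrier_mat r r" and D': "D' \<in> carrier_mat r r"
    by (simp_all add: D_def D'_def Sigma_inv_sqrt_def)
  have F: "mat_adjoint Ur * E * Vr \<in> carrier_mat r r"
    using Ur E Vr by (auto simp: mult_carrier_mat[of _ r m])
  have K: "K \<in> carrier_mat r r" using D' F by (simp add: K_def)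
  have "complex_of_real (sqrt (sigma (Suc j) A)) * complex_of_real (sigma (Suc j) A powr (- 1 / 2)) = 1"
    if "j < r" for j
    unfolding of_real_mult[symmetric] using sqrt_mult_powr_minus_half[OF pos[OF that]] by (simp only: of_real_1)
  then have DD': "D * D' = 1\<^sub>m r" and D'D: "D' * D = 1\<^sub>m r"
    unfolding D_def D'_def Sigma_inv_sqrt_def mat_diag_diag
    by (auto simp only: mult.commute mat_diag_def intro!: eq_matI) auto
  have "complex_of_real (sqrt (sigma (Suc j) A)) * complex_of_real (sqrt (sigma (Suc j) A)) =
      complex_of_real (sigma (Suc j) A)" if "j < r" for j
    using pos[OF that] by (simp flip: of_real_mult)
  then have DD: "D * D = Sigma_mat r A"
    unfolding D_def Sigma_mat_def mat_diag_diag by (auto simp: mat_diag_def intro!: eq_matI)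
  \<comment> \<open>The matrix \<open>S\<^sup>+ E S\<^sup>+\<close> equals \<open>V\<^sub>r K U\<^sub>r\<^sup>*\<close>, so \<open>K\<close> inherits its norm bound.\<close>
  have K_le: "vec_norm (K *\<^sub>v z) \<le> k * vec_norm z" if z: "z \<in> carrier_vec r" for z
  proof -
    define G where "G = S_plus r A U V * E * S_plus r A U V"
    have S: "S_plus r A U V = Vr * D' * mat_adjoint Ur"
      by (simp add: S_plus_def Ur_def Vr_def D'_def)
    have G: "G \<in> carrier_mat n m"
      unfolding G_def S using Vr D' Ur E by auto
    have "G = Vr * K * mat_adjoint Ur"
      unfolding G_def S K_def using Vr D' Ur E by (simp add: mult_mat_assoc)
    then have "G * Ur = Vr * K"
      using Vr K Ur by (simp add: mult_mat_assoc UU)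
    then have "G *\<^sub>v (Ur *\<^sub>v z) = Vr *\<^sub>v (K *\<^sub>v z)"
      using assoc_mult_mat_vec[OF G Ur z] assoc_mult_mat_vec[OF Vr K z] by simp
    then have "vec_norm (K *\<^sub>v z) = vec_norm (G *\<^sub>v (Ur *\<^sub>v z))"
      using vec_norm_isometry[OF Vr VV, of "K *\<^sub>v z"] K by simp
    also have "\<dots> \<le> norm2_mat G * vec_norm (Ur *\<^sub>v z)"
      using Ur by (intro vec_norm_le_norm2_mat[OF G]) simp
    finally show ?thesis
      using assms(6) by (simp add: G_def vec_norm_isometry[OF Ur UU z])
  qed
  have "mat_adjoint Ur * (A + E) * Vr = mat_adjoint Ur * A * Vr + mat_adjoint Ur * E * Vr"
    using Ur Vr A E by (simp add: mult_add_distrib_mat[of _ r m _ n] add_mult_distrib_mat[of _ r n]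
        mult_carrier_mat[of _ r m])
  also have "mat_adjoint Ur * E * Vr = D * K * D"
  proof -
    have "D * K * D = (D * D') * (mat_adjoint Ur * E * Vr) * (D' * D)"
      unfolding K_def using D D' Ur E Vr by (simp add: mult_mat_assoc)
    also have "\<dots> = mat_adjoint Ur * E * Vr"
      unfolding DD' D'D left_mult_one_mat[OF F] by (rule right_mult_one_mat[OF F])
    finally show ?thesis by (rule sym)
  qed
  also have "mat_adjoint Ur * A * Vr + D * K * D = D * (1\<^sub>m r + K) * D"
    unfolding UAV DD[symmetric] using D K
    by (simp add: mult_add_distrib_mat[of _ r r _ r] add_mult_distrib_mat[of _ r r] mult_mat_assoc)
  finally have comp: "mat_adjoint Ur * (A + E) * Vr = D * (1\<^sub>m r + K) * D" .
  interpret accretive_compression m n r "A + E" Ur Vr K "\<lambda>j. sigma (Suc j) A" k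
  proof
    show "sigma (Suc j) A \<le> sigma (Suc i) A" if "i \<le> j" "j < r" for i j
      using that r by (intro sigma_antimono) (auto simp: dimA)
  qed (use r \<open>n \<le> m\<close> A E Ur UU Vr VV K K_le \<open>k \<le> 1\<close> pos comp in \<open>auto simp: D_def\<close>)
  show ?thesis
    using sigma_upper sigma_lower by (auto simp: algebra_simps)
qed

end
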